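(* Let \(m,b,s\) be fixed positive integer constants (with \(s \ge 1\)), and consider the \((m,b)\)-Maker-Breaker game played on the random \(s\)-uniform hypergraph \(H_{n,s,p}\). Let \(p_0 = p_0(n)\) denote the weak threshold for the property that Maker has a winning strategy in this game. Then: (i) if \(s \le m\) or \(b < m\), then \(p_0 = n^{-s}\); (ii) if \(m = s-1 \le b\), then \(p_0 = n^{1 - s - \left\lceil \frac{b+1}{m} \right\rceil^{-1}}\); (iii) if \(m \le s-2\) and \(m \le b\), then \(p_0 = n^{1-s}\), and moreover the threshold is semi-sharp: there exist constants \(0 < c_1 \le c_2\) such that if \(p \le c_1 n^{1-s}\) then w.h.p. Breaker has a winning strategy, and if \(p \ge c_2 n^{1-s}\) then w.h.p. Maker has a winning strategy.
   Context: A hypergraph is a pair \(H=(V,E)\) with \(V\) a finite set and \(E \subseteq 2^V\); it is \(s\)-uniform if every edge has exactly \(s\) vertices. \(H_{n,s,p}\) is the random hypergraph on \(n\) vertices obtained from the complete \(s\)-uniform hypergraph on \(n\) vertices by keeping each edge independently with probability \(p\). The \((m,b)\)-Maker-Breaker game on a hypergraph \(H=(V,E)\): two players, Maker and Breaker, alternately pick unpicked vertices of \(V\), Maker picking \(m\) vertices per turn and Breaker \(b\) vertices per turn (fewer if fewer remain), Maker moving first, until all vertices are picked. Maker wins if the set of vertices he picked contains some edge \(e \in E\); otherwise Breaker wins. "W.h.p." means with probability tending to \(1\) as \(n \to \infty\). A function \(p_0(n)\) is a weak threshold for a property \(\mathcal{P}\) if \(H_{n,s,p}\) has \(\mathcal{P}\)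 w.h.p. whenever \(p = \omega(p_0)\), and \(H_{n,s,p}\) does not have \(\mathcal{P}\) w.h.p. whenever \(p = o(p_0)\). *)

theory Defs
  imports "HOL-Probability.Probability" "HOL-Library.Landau_Symbols"
begin

section \<open>Hypergraphs\<close>

type_synonym 'a hypergraph = "'a set \<times> 'a set set"

abbreviation verts :: "'a hypergraph \<Rightarrow> 'a set" where "verts \<equiv> fst"

abbreviation edges :: "'a hypergraph \<Rightarrow> 'a set set" where "edges \<equiv> snd"

definition hypergraph :: "'a hypergraph \<Rightarrow> bool" where
  "hypergraph H \<longleftrightarrow> finite (verts H) \<and> edges H \<subseteq> Pow (verts H)"

definition uniform :: "nat \<Rightarrow> 'a hypergraph \<Rightarrow> bool" where
  "uniform s H \<longleftrightarrow> (\<forall>e\<in>edges H. card e = s)"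

definition complete_uniform :: "nat \<Rightarrow> nat \<Rightarrow> nat hypergraph" where
  "complete_uniform n s = ({..<n}, {e. e \<subseteq> {..<n} \<and> card e = s})"

text \<open>Each edge of the complete hypergraph is kept according to its own independent coin flip.\<close>

definition random_hypergraph :: "nat \<Rightarrow> nat \<Rightarrow> real \<Rightarrow> nat hypergraph pmf" where
  "random_hypergraph n s p =
     map_pmf (\<lambda>keep. (verts (complete_uniform n s), {e \<in> edges (complete_uniform n s). keep e}))
       (Pi_pmf (edges (complete_uniform n s)) False (\<lambda>_. bernoulli_pmf p))"

lemma random_hypergraph_uniform:
  assumes "H \<in> set_pmf (random_hypergraph n s p)"
  shows "hypergraph H" "uniform s H" "verts H = {..<n}"
  using assms
  by (auto simp: random_hypergraph_def complete_uniform_def hypergraph_def uniform_def)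


section \<open>The Maker-Breaker game\<close>

datatype player = Maker | Breaker

text \<open>A history is the list of the moves made so far, each move being the set of vertices picked
  in that turn; the players alternate and Maker makes move number 0.\<close>

definition turn :: "nat \<Rightarrow> player" where
  "turn i = (if even i then Maker else Breaker)"

definition quota :: "nat \<Rightarrow> nat \<Rightarrow> player \<Rightarrow> nat" where
  "quota m b P = (case P of Maker \<Rightarrow> m | Breaker \<Rightarrow> b)"

definition unpicked :: "'a set \<Rightarrow> 'a set list \<Rightarrow> 'a set" where
  "unpicked V h = V - \<Union>(set h)"

definition legal_move :: "nat \<Rightarrow> nat \<Rightarrow> 'a set \<Rightarrow> 'a set list \<Rightarrow> 'a set \<Rightarrow> bool" where
  "legal_move m b V h X \<longleftrightarrow>
     X \<subseteq> unpicked V h \<and> card X = min (quota m b (turn (length h))) (card (unpicked V h))"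

text \<open>Play stops as soon as all vertices are picked, so no move follows a finished history.\<close>

definition legal_history :: "nat \<Rightarrow> nat \<Rightarrow> 'a set \<Rightarrow> 'a set list \<Rightarrow> bool" where
  "legal_history m b V h \<longleftrightarrow>
     (\<forall>i<length h. unpicked V (take i h) \<noteq> {} \<and> legal_move m b V (take i h) (h ! i))"

definition picked_by :: "player \<Rightarrow> 'a set list \<Rightarrow> 'a set" where
  "picked_by P h = \<Union>{h ! i | i. i < length h \<and> turn i = P}"

definition winner :: "'a hypergraph \<Rightarrow> 'a set list \<Rightarrow> player" where
  "winner H h = (if \<exists>e\<in>edges H. e \<subseteq> picked_by Maker h then Maker else Breaker)"

definition strategy ::
  "nat \<Rightarrow> nat \<Rightarrow> 'a set \<Rightarrow> player \<Rightarrow> ('a set list \<Rightarrow> 'a set) \<Rightarrow> bool" where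
  "strategy m b V P \<sigma> \<longleftrightarrow>
     (\<forall>h. legal_history m b V h \<and> unpicked V h \<noteq> {} \<and> turn (length h) = P \<longrightarrow>
        legal_move m b V h (\<sigma> h))"

definition follows :: "player \<Rightarrow> ('a set list \<Rightarrow> 'a set) \<Rightarrow> 'a set list \<Rightarrow> bool" where
  "follows P \<sigma> h \<longleftrightarrow> (\<forall>i<length h. turn i = P \<longrightarrow> h ! i = \<sigma> (take i h))"

definition has_winning_strategy :: "nat \<Rightarrow> nat \<Rightarrow> player \<Rightarrow> 'a hypergraph \<Rightarrow> bool" where
  "has_winning_strategy m b P H \<longleftrightarrow>
     (\<exists>\<sigma>. strategy m b (verts H) P \<sigma> \<and>
        (\<forall>h. legal_history m b (verts H) h \<and> unpicked (verts H) h = {} \<and> follows P \<sigma> h \<longrightarrow>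
           winner H h = P))"


section \<open>Thresholds\<close>

definition whp :: "nat \<Rightarrow> (nat \<Rightarrow> real) \<Rightarrow> (nat hypergraph \<Rightarrow> bool) \<Rightarrow> bool" where
  "whp s p Q \<longleftrightarrow>
     (\<lambda>n. measure_pmf.prob (random_hypergraph n s (p n)) {H. Q H}) \<longlonglongrightarrow> 1"

definition edge_prob :: "(nat \<Rightarrow> real) \<Rightarrow> bool" where
  "edge_prob p \<longleftrightarrow> (\<forall>n. 0 \<le> p n \<and> p n \<le> 1)"

definition weak_threshold ::
  "nat \<Rightarrow> (nat hypergraph \<Rightarrow> bool) \<Rightarrow> (nat \<Rightarrow> real) \<Rightarrow> bool" where
  "weak_threshold s Q p\<^sub>0 \<longleftrightarrow>
     (\<forall>p. edge_prob p \<longrightarrow>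
        (p \<in> \<omega>(p\<^sub>0) \<longrightarrow> whp s p Q) \<and>
        (p \<in> o(p\<^sub>0) \<longrightarrow> whp s p (\<lambda>H. \<not> Q H)))"

end

theory Submission
  imports Defs
begin

text \<open>
  Breaker's strategies are pairing strategies: if every edge \<open>e\<close> gets a private part \<open>g e\<close> with more
  than \<open>m\<close> vertices, and the \<open>m\<close> vertices of one Maker turn meet at most \<open>b\<close> private parts, Breaker
  answers inside each part that has just been touched. Below the threshold in (ii) all degrees
  are small and \<open>g e = e\<close> works; in (iii) a first moment bound excludes every set \<open>F\<close> of edges
  spanning fewer than \<open>(s - 1) * |F|\<close> vertices, and Hall's theorem yields disjoint private parts
  of size \<open>s - 1 > m\<close>.

  Maker wins in (i) on constantly many disjoint edges; in (ii) by first taking the centres of \<open>m\<close>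
  disjoint stars with at least \<open>b + 1\<close> rays altogether; in (iii) by Beck's potential argument, as
  the hypergraph has linearly many edges while any two vertices share at most two of them.
  Placing the structures for (i) and (ii) in prescribed disjoint blocks of vertices makes the
  relevant events independent, so that no second moment is needed.
\<close>

section \<open>The game\<close>

text \<open>The exponent in (ii) comes from \<open>k\<close>, the least integer with
  \<open>m * k > b\<close>. A vertex in \<open>k\<close> edges should appear once
  \<open>n * (n ^ m * p) ^ k\<close> is of constant order, that is, at
  \<open>p = n powr (- (m + 1 / k))\<close>. Below that, Breaker has to answer at most
  \<open>m * (k - 1) \<le> b\<close> edges touched in one turn; above it, \<open>m\<close> centres
  with \<open>k\<close> rays each have more rays than he can block.

  In (iii) the pair degrees are bounded only near the threshold. Having many edges is an increasing
  property, having small pair degrees a decreasing one; for larger \<open>p\<close> the hypergraph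
  is therefore thinned by a coupling to density of order \<open>n powr (1 - s)\<close>, and Maker
  plays on the thinned edges.

  Private parts of size \<open>s - 1\<close> are affordable because \<open>t\<close> vertices
  carrying \<open>f > t / (s - 1)\<close> edges have, for fixed \<open>t\<close>, expected number of
  order at most \<open>n powr (t - (s - 1) * f)\<close>, hence at most \<open>1 / n\<close>. The
  difficulty is uniformity over all \<open>t\<close> up to \<open>n\<close>, and this is what fixes
  Breaker's constant.\<close>

lemma legal_history_Nil [simp]: "legal_history m b V []"
  by (simp add: legal_history_def)

lemma legal_history_snoc:
  "legal_history m b V (h @ [X]) \<longleftrightarrow>
     legal_history m b V h \<and> unpicked V h \<noteq> {} \<and> legal_move m b V h X"
  unfolding legal_history_def by (auto simp: nth_append less_Suc_eq all_conj_distrib)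

lemma follows_Nil [simp]: "follows P \<sigma> []"
  by (simp add: follows_def)

lemma follows_snoc:
  "follows P \<sigma> (h @ [X]) \<longleftrightarrow> follows P \<sigma> h \<and> (turn (length h) = P \<longrightarrow> X = \<sigma> h)"
  unfolding follows_def by (auto simp: nth_append less_Suc_eq all_conj_distrib)

lemma picked_by_Nil [simp]: "picked_by P [] = {}"
  by (simp add: picked_by_def)

lemma picked_by_snoc:
  "picked_by P (h @ [X]) = picked_by P h \<union> (if turn (length h) = P then X else {})"
  unfolding picked_by_def by (auto simp: nth_append less_Suc_eq)

lemma unpicked_Nil [simp]: "unpicked V [] = V"
  by (simp add: unpicked_def)

lemma unpicked_snoc: "unpicked V (h @ [X]) = unpicked V h - X"
  by (auto simp: unpicked_def)

lemma unpicked_eq: "unpicked V h = V - picked_by Maker h - picked_by Breaker h"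
proof (induction h rule: rev_induct)
  case (snoc X h)
  then show ?case
    by (cases "turn (length h)") (auto simp: unpicked_snoc picked_by_snoc)
qed simp

lemma legal_history_picked:
  assumes "legal_history m b V h"
  shows "picked_by Maker h \<union> picked_by Breaker h \<subseteq> V \<and> picked_by Maker h \<inter> picked_by Breaker h = {}"
  using assms
proof (induction h rule: rev_induct)
  case (snoc X h)
  then show ?case
    by (cases "turn (length h)")
       (auto simp: legal_history_snoc picked_by_snoc legal_move_def unpicked_eq)
qed simp

section \<open>Strategies from invariants\<close>

lemma ex_move_between:
  fixes U :: "'a set"
  assumes "finite U" "X\<^sub>0 \<subseteq> U" "card X\<^sub>0 \<le> k"
  obtains X where "X\<^sub>0 \<subseteq> X" "X \<subseteq> U" "card X = min k (card U)"
proof -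
  have "card X\<^sub>0 \<le> min k (card U)" using assms by (simp add: card_mono)
  then show thesis
    using exists_subset_between[of X\<^sub>0 "min k (card U)" U] assms that by auto
qed

lemma ex_legal_move:
  assumes "finite V"
  shows "\<exists>X. legal_move m b V h X"
proof -
  have "finite (unpicked V h)" using assms by (simp add: unpicked_def)
  then obtain X where "X \<subseteq> unpicked V h" "card X = min (quota m b (turn (length h))) (card (unpicked V h))"
    using ex_move_between[of "unpicked V h" "{}"] by auto
  then show ?thesis by (auto simp: legal_move_def)
qed

text \<open>Strategies are functions of the history, whereas the arguments below are invariants.
  Choosing at each turn some legal move that restores \<open>J\<close> yields the strategy without
  writing it down.\<close>

lemma winning_strategyI:
  assumes fin: "finite (verts H)"
    and init: "J []"
    and opp: "\<And>h X. legal_history m b (verts H) h \<Longrightarrow> J h \<Longrightarrow> unpicked (verts H) h \<noteq> {} \<Longrightarrow>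
      turn (length h) \<noteq> P \<Longrightarrow> legal_move m b (verts H) h X \<Longrightarrow> J (h @ [X])"
    and own: "\<And>h. legal_history m b (verts H) h \<Longrightarrow> J h \<Longrightarrow> unpicked (verts H) h \<noteq> {} \<Longrightarrow>
      turn (length h) = P \<Longrightarrow> \<exists>X. legal_move m b (verts H) h X \<and> J (h @ [X])"
    and win: "\<And>h. legal_history m b (verts H) h \<Longrightarrow> J h \<Longrightarrow> unpicked (verts H) h = {} \<Longrightarrow> winner H h = P"
  shows "has_winning_strategy m b P H"
proof -
  let ?V = "verts H"
  \<comment> \<open>\<open>strategy\<close> asks for legal moves on all histories, also on those
    where \<open>J\<close> fails; hence the guarded implication, with \<open>ex_legal_move\<close>
    for the remaining histories.\<close>
  define \<sigma> where "\<sigma> h = (SOME X. legal_move m b ?V h X \<and> (J h \<longrightarrow> J (h @ [X])))" for h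
  have \<sigma>: "legal_move m b ?V h (\<sigma> h) \<and> (J h \<longrightarrow> J (h @ [\<sigma> h]))"
    if "legal_history m b ?V h" "unpicked ?V h \<noteq> {}" "turn (length h) = P" for h
    unfolding \<sigma>_def
    by (rule someI_ex) (use own[OF that(1)] that ex_legal_move[OF fin] in blast)
  have J: "J h" if "legal_history m b ?V h" "follows P \<sigma> h" for h
    using that
  proof (induction h rule: rev_induct)
    case Nil
    then show ?case by (simp add: init)
  next
    case (snoc X h)
    then show ?case
      using \<sigma>[of h] opp[of h X]
      by (cases "turn (length h) = P") (auto simp: legal_history_snoc follows_snoc)
  qed
  show ?thesis
    unfolding has_winning_strategy_def strategy_def using \<sigma> J win by blast
qed

text \<open>Winning speaks only of finished plays, so excluding that both players win requires a
  finished play that follows both strategies. Positive quotas make every move nonempty, so the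
  unpicked set shrinks until it is empty.\<close>

lemma ex_complete_play:
  assumes fin: "finite V" and m: "m \<ge> 1" and b: "b \<ge> 1"
    and \<sigma>: "strategy m b V Maker \<sigma>" and \<tau>: "strategy m b V Breaker \<tau>"
  shows "\<exists>h. legal_history m b V h \<and> unpicked V h = {} \<and> follows Maker \<sigma> h \<and> follows Breaker \<tau> h"
proof -
  have "\<exists>h'. legal_history m b V h' \<and> unpicked V h' = {} \<and> follows Maker \<sigma> h' \<and> follows Breaker \<tau> h'"
    if "legal_history m b V h" "follows Maker \<sigma> h" "follows Breaker \<tau> h" for h
    using that
  proof (induction "card (unpicked V h)" arbitrary: h rule: less_induct)
    case less
    show ?case
    proof (cases "unpicked V h = {}")
      case True
      with less show ?thesis by blast
    next
      case False
      define X where "X = (if turn (length h) = Maker then \<sigma> h else \<tau> h)"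
      have X: "legal_move m b V h X"
        using \<sigma> \<tau> less.prems False unfolding strategy_def X_def
        by (cases "turn (length h)") auto
      have fU: "finite (unpicked V h)" using fin by (simp add: unpicked_def)
      have "card (unpicked V h) > 0" using False fU by (simp add: card_gt_0_iff)
      then have "card X > 0"
        using X m b by (cases "turn (length h)") (auto simp: legal_move_def quota_def)
      then have "X \<noteq> {}" by auto
      with X have "unpicked V (h @ [X]) \<subset> unpicked V h"
        by (auto simp: unpicked_snoc legal_move_def)
      then have "card (unpicked V (h @ [X])) < card (unpicked V h)"
        using fU by (rule psubset_card_mono[rotated])
      moreover have "legal_history m b V (h @ [X])" "follows Maker \<sigma> (h @ [X])" "follows Breaker \<tau> (h @ [X])"
        using less.prems False X by (auto simp: legal_history_snoc follows_snoc X_def)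
      ultimately show ?thesis using less.hyps by blast
    qed
  qed
  then show ?thesis by (metis legal_history_Nil follows_Nil)
qed

lemma not_Maker_and_Breaker_win:
  assumes "finite (verts H)" "m \<ge> 1" "b \<ge> 1" "has_winning_strategy m b Breaker H"
  shows "\<not> has_winning_strategy m b Maker H"
proof
  assume "has_winning_strategy m b Maker H"
  with assms ex_complete_play[OF assms(1-3)] obtain h where "winner H h = Maker" "winner H h = Breaker"
    unfolding has_winning_strategy_def by blast
  then show False by simp
qed

section \<open>Winning criteria for Maker and Breaker\<close>

text \<open>Passes from histories to positions \<open>(M, B)\<close> at Maker's turns. At the end
  every vertex is taken, so an edge avoiding \<open>B\<close> is Maker's; this is why
  \<open>win\<close> asks only for an unhit edge. Replies \<open>Y\<close> of every size up to
  \<open>b\<close> are allowed, which covers a short last move and a play that ends with Maker's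
  move.\<close>

lemma Maker_winsI:
  assumes fin: "finite V" and EV: "E \<subseteq> Pow V"
    and init: "I {} {}"
    and step: "\<And>M B. M \<union> B \<subseteq> V \<Longrightarrow> M \<inter> B = {} \<Longrightarrow> I M B \<Longrightarrow> V - M - B \<noteq> {} \<Longrightarrow>
      \<exists>X\<subseteq>V - M - B. card X = min m (card (V - M - B)) \<and>
        (\<forall>Y\<subseteq>V - M - B - X. card Y \<le> b \<longrightarrow> I (M \<union> X) (B \<union> Y))"
    and win: "\<And>M B. I M B \<Longrightarrow> \<exists>e\<in>E. e \<inter> B = {}"
  shows "has_winning_strategy m b Maker (V, E)"
proof -
  define J where "J h \<longleftrightarrow> (let M = picked_by Maker h; B = picked_by Breaker h in
     (turn (length h) = Maker \<longrightarrow> I M B) \<and>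
     (turn (length h) = Breaker \<longrightarrow> (\<forall>Y\<subseteq>V - M - B. card Y \<le> b \<longrightarrow> I M (B \<union> Y))))"
    for h
  show ?thesis
  proof (rule winning_strategyI[where J = J], goal_cases)
    case 1
    then show ?case using fin by simp
  next
    case 2
    then show ?case by (simp add: J_def init turn_def)
  next
    case (3 h X)
    then have "turn (length h) = Breaker" by (cases "turn (length h)") auto
    moreover from this have "turn (length (h @ [X])) = Maker" by (auto simp: turn_def split: if_splits)
    ultimately show ?case using 3
      by (auto simp: J_def Let_def picked_by_snoc legal_move_def unpicked_eq quota_def)
  next
    case (4 h)
    let ?M = "picked_by Maker h" and ?B = "picked_by Breaker h"
    have t: "turn (length (h @ [X])) = Breaker" for X using 4(4) by (auto simp: turn_def split: if_splits)
    have "I ?M ?B" using 4 by (simp add: J_def Let_def)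
    then obtain X where X: "X \<subseteq> V - ?M - ?B" "card X = min m (card (V - ?M - ?B))"
      "\<forall>Y\<subseteq>V - ?M - ?B - X. card Y \<le> b \<longrightarrow> I (?M \<union> X) (?B \<union> Y)"
      using step[of ?M ?B] legal_history_picked[of m b V h] 4 by (auto simp: unpicked_eq)
    have "V - (?M \<union> X) - ?B = V - ?M - ?B - X" by auto
    with X t 4 have "legal_move m b (verts (V, E)) h X \<and> J (h @ [X])"
      by (simp add: J_def Let_def picked_by_snoc legal_move_def unpicked_eq quota_def)
    then show ?case ..
  next
    case (5 h)
    let ?M = "picked_by Maker h" and ?B = "picked_by Breaker h"
    have "I ?M ?B"
    proof (cases "turn (length h)")
      case Breaker
      \<comment> \<open>Maker made the last move; the empty set stands in for Breaker's
        reply.\<close>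
      with 5(2) have "I ?M (?B \<union> {})" unfolding J_def Let_def by (metis card.empty empty_subsetI le0)
      then show ?thesis by simp
    qed (use 5(2) in \<open>auto simp: J_def Let_def\<close>)
    then obtain e where e: "e \<in> E" "e \<inter> ?B = {}" using win by blast
    with 5(3) EV have "e \<subseteq> ?M" by (auto simp: unpicked_eq)
    with e show ?case by (auto simp: winner_def)
  qed
qed

text \<open>Extra vertices never hurt Breaker (\<open>mono\<close>), so \<open>step\<close> may name
  only the vertices that matter, and the rest of his quota is filled arbitrarily.\<close>

lemma Breaker_winsI:
  assumes fin: "finite V"
    and init: "I {} {}"
    and step: "\<And>M B X. M \<union> B \<subseteq> V \<Longrightarrow> M \<inter> B = {} \<Longrightarrow> I M B \<Longrightarrow> X \<subseteq> V - M - B \<Longrightarrow> card X \<le> m \<Longrightarrow>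
      \<exists>Y\<subseteq>V - M - B - X. card Y \<le> b \<and> I (M \<union> X) (B \<union> Y)"
    and mono: "\<And>M B B'. I M B \<Longrightarrow> B \<subseteq> B' \<Longrightarrow> I M B'"
    and win: "\<And>M B e. I M B \<Longrightarrow> M \<inter> B = {} \<Longrightarrow> e \<in> E \<Longrightarrow> \<not> e \<subseteq> M"
  shows "has_winning_strategy m b Breaker (V, E)"
proof -
  define J where "J h \<longleftrightarrow> (let M = picked_by Maker h; B = picked_by Breaker h in
     (turn (length h) = Maker \<longrightarrow> I M B) \<and>
     (turn (length h) = Breaker \<longrightarrow> (\<exists>Y\<subseteq>V - M - B. card Y \<le> b \<and> I M (B \<union> Y))))"
    for h
  show ?thesis
  proof (rule winning_strategyI[where J = J], goal_cases)
    case 1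
    then show ?case using fin by simp
  next
    case 2
    then show ?case by (simp add: J_def init turn_def)
  next
    case (3 h X)
    then have "turn (length h) = Maker" by (cases "turn (length h)") auto
    moreover from this have "turn (length (h @ [X])) = Breaker" by (auto simp: turn_def split: if_splits)
    moreover have "V - (picked_by Maker h \<union> X) - picked_by Breaker h
        = V - picked_by Maker h - picked_by Breaker h - X" by auto
    ultimately show ?case using 3 legal_history_picked[of m b V h]
        step[of "picked_by Maker h" "picked_by Breaker h" X]
      by (auto simp: J_def Let_def picked_by_snoc legal_move_def unpicked_eq quota_def)
  next
    case (4 h)
    have t: "turn (length (h @ [X])) = Maker" for X using 4(4) by (auto simp: turn_def split: if_splits)
    obtain Y where Y: "Y \<subseteq> unpicked V h" "card Y \<le> b" "I (picked_by Maker h) (picked_by Breaker h \<union> Y)"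
      using 4 by (auto simp: J_def Let_def unpicked_eq)
    have "finite (unpicked V h)" using fin by (simp add: unpicked_def)
    from ex_move_between[OF this Y(1,2)] obtain X where
      X: "Y \<subseteq> X" "X \<subseteq> unpicked V h" "card X = min b (card (unpicked V h))" .
    have "I (picked_by Maker h) (picked_by Breaker h \<union> X)"
      using Y(3) X(1) by (elim mono) auto
    with X t 4 show ?case
      by (auto simp: J_def Let_def picked_by_snoc legal_move_def quota_def intro!: exI[of _ X])
  next
    case (5 h)
    let ?M = "picked_by Maker h" and ?B = "picked_by Breaker h"
    have "I ?M ?B"
    proof (cases "turn (length h)")
      case Breaker
      with 5(2) obtain Y where "Y \<subseteq> unpicked V h" "I ?M (?B \<union> Y)"
        by (auto simp: J_def Let_def unpicked_eq)
      with 5(3) show ?thesis by simp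
    qed (use 5(2) in \<open>auto simp: J_def Let_def\<close>)
    then show ?case using win[of ?M ?B] legal_history_picked[OF 5(1)] by (auto simp: winner_def)
  qed
qed

text \<open>The invariant is that every part touched by Maker also contains a Breaker vertex. A part
  not hit by Breaker is thus free of Maker before Maker's turn, and with more than \<open>m\<close>
  vertices it cannot be swallowed in one turn.\<close>

lemma Breaker_wins_private:
  assumes fin: "finite V" and EV: "E \<subseteq> Pow V"
    and g: "\<And>e. e \<in> E \<Longrightarrow> g e \<subseteq> e \<and> m < card (g e)"
    and d: "\<And>v. card {e \<in> E. v \<in> g e} \<le> d" and db: "m * d \<le> b"
  shows "has_winning_strategy m b Breaker (V, E)"
proof (rule Breaker_winsI[where I = "\<lambda>M B. \<forall>e\<in>E. g e \<inter> M \<noteq> {} \<longrightarrow> g e \<inter> B \<noteq> {}", OF fin], goal_cases)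
  case (2 M B X)
  have finE: "finite E" using fin EV by (meson finite_Pow_iff finite_subset)
  define T where "T = {e \<in> E. g e \<inter> X \<noteq> {} \<and> g e \<inter> B = {}}"
  have finX: "finite X" using 2(4) fin by (meson finite_Diff finite_subset)
  have "\<exists>y. y \<in> g e - X" if "e \<in> T" for e
  proof (rule ccontr)
    assume "\<nexists>y. y \<in> g e - X"
    then have "g e \<subseteq> X" by auto
    then have "card (g e) \<le> card X" using finX by (simp add: card_mono)
    with 2(5) g[of e] that show False by (auto simp: T_def)
  qed
  then obtain y where y: "\<And>e. e \<in> T \<Longrightarrow> y e \<in> g e - X" by metis
  have "card T \<le> card (\<Union>v\<in>X. {e \<in> E. v \<in> g e})"
    by (rule card_mono) (use finX finE in \<open>auto simp: T_def\<close>)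
  also have "\<dots> \<le> (\<Sum>v\<in>X. card {e \<in> E. v \<in> g e})" by (rule card_UN_le[OF finX])
  also have "\<dots> \<le> (\<Sum>v\<in>X. d)" by (rule sum_mono) (rule d)
  also have "\<dots> \<le> m * d" using 2(5) by simp
  finally have "card T \<le> b" using db by linarith
  moreover have "card (y ` T) \<le> card T"
    by (rule card_image_le) (use finE in \<open>auto simp: T_def\<close>)
  moreover have "y ` T \<subseteq> V - M - B - X"
  proof (clarify, goal_cases)
    case (1 _ e)
    have "g e \<inter> B = {}" "e \<in> E" using 1 by (auto simp: T_def)
    moreover from this have "g e \<inter> M = {}" using 2(3) by auto
    ultimately show ?case using y[OF 1] g[of e] EV by blast
  qed
  moreover have "\<forall>e\<in>E. g e \<inter> (M \<union> X) \<noteq> {} \<longrightarrow> g e \<inter> (B \<union> y ` T) \<noteq> {}"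
  proof (intro ballI impI)
    fix e assume e: "e \<in> E" "g e \<inter> (M \<union> X) \<noteq> {}"
    show "g e \<inter> (B \<union> y ` T) \<noteq> {}"
    proof (cases "e \<in> T")
      case True
      then show ?thesis using y by blast
    next
      case False
      then show ?thesis using e 2(3) by (auto simp: T_def)
    qed
  qed
  ultimately show ?case by (meson le_trans)
next
  case (4 M B e)
  show ?case
  proof
    assume "e \<subseteq> M"
    with g[OF 4(3)] have "g e \<inter> M = g e" "g e \<noteq> {}" by auto
    with 4(1,3) have "g e \<inter> B \<noteq> {}" by blast
    with \<open>g e \<inter> M = g e\<close> 4(2) show False by blast
  qed
qed blast+

text \<open>Serves two situations: \<open>C\<close> consists of the centres of stars and the second
  move takes a ray, or \<open>C\<close> already contains an edge and \<open>card (e - C)\<close> is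
  0. After the second move the surviving edge lies inside Maker's set, so the invariant
  persists.\<close>

lemma Maker_wins_two_moves:
  assumes fin: "finite V" and EV: "E \<subseteq> Pow V" and C: "C \<subseteq> V" "card C = m"
    and Y: "\<And>Y. Y \<subseteq> V - C \<Longrightarrow> card Y \<le> b \<Longrightarrow> \<exists>e\<in>E. e \<inter> Y = {} \<and> card (e - C) \<le> m"
  shows "has_winning_strategy m b Maker (V, E)"
proof (rule Maker_winsI[where I = "\<lambda>M B. M = {} \<and> B = {} \<or> (\<exists>e\<in>E. e \<inter> B = {} \<and> card (e - M) \<le> m)", OF fin EV], goal_cases)
  case (2 M B)
  from 2(3) consider "M = {}" "B = {}" | e where "e \<in> E" "e \<inter> B = {}" "card (e - M) \<le> m" by blast
  then show ?case
  proof cases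
    case 1
    have "card C \<le> card V" by (rule card_mono[OF fin C(1)])
    then show ?thesis using 1 C Y by (intro exI[of _ C]) auto
  next
    case (2 e)
    have "e - M \<subseteq> V - M - B" using 2 EV by blast
    moreover have "finite (V - M - B)" using fin by simp
    ultimately obtain X where X: "e - M \<subseteq> X" "X \<subseteq> V - M - B" "card X = min m (card (V - M - B))"
      using ex_move_between[of "V - M - B" "e - M" m] 2(3) by blast
    have "e \<inter> (B \<union> Y) = {} \<and> card (e - (M \<union> X)) \<le> m" if "Y \<subseteq> V - M - B - X" for Y
    proof -
      have "e - (M \<union> X) = {}" using X(1) by blast
      then have "card (e - (M \<union> X)) = 0" by (metis card.empty)
      moreover have "e \<inter> Y = {}" using X(1) that by blast
      ultimately show ?thesis using 2 by (simp add: Int_Un_distrib)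
    qed
    then have "\<forall>Y\<subseteq>V - M - B - X. \<exists>e\<in>E. e \<inter> (B \<union> Y) = {} \<and> card (e - (M \<union> X)) \<le> m"
      using 2(1) by metis
    with X(2,3) show ?thesis by metis
  qed
next
  case (3 M B)
  have "\<exists>e\<in>E. e \<inter> {} = {} \<and> card (e - C) \<le> m" by (rule Y) auto
  with 3 show ?case by blast
qed simp

text \<open>A potential for disjoint edges: \<open>U\<close> consists of edges in which Maker misses at most \<open>r + 1\<close>
  vertices, \<open>A\<close> of edges in which he misses at most \<open>r\<close>, and \<open>card U + (m + b) * card A\<close> does not
  decrease when Maker plays in \<open>m\<close> edges of \<open>U\<close> and Breaker destroys \<open>b\<close> edges. Once \<open>U\<close> is used up,
  \<open>A\<close> takes its role with \<open>r - 1\<close> instead of \<open>r\<close>.\<close>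

lemma Maker_wins_boxes:
  assumes fin: "finite V" and EV: "E \<subseteq> Pow V" and D: "D \<subseteq> E" "disjoint D"
    and s: "\<And>e. e \<in> D \<Longrightarrow> card e \<le> s" and s1: "s \<ge> 1"
    and bm: "b < m" and cD: "card D \<ge> (m + b) ^ s"
  shows "has_winning_strategy m b Maker (V, E)"
proof -
  have finE: "finite E" using fin EV by (meson finite_Pow_iff finite_subset)
  have finD: "finite D" using finE D by (rule_tac finite_subset)
  define L where "L r M B A U \<longleftrightarrow> A \<union> U \<subseteq> D \<and> A \<inter> U = {} \<and> (\<forall>e\<in>A \<union> U. e \<inter> B = {}) \<and>
     (\<forall>e\<in>A. card (e - M) \<le> r) \<and> (\<forall>e\<in>U. card (e - M) \<le> Suc r) \<and>
     card U + (m + b) * card A \<ge> (m + b) ^ Suc r" for r M B and A U :: "'a set set"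
  define I where "I M B \<longleftrightarrow> (\<exists>e\<in>E. e \<inter> B = {} \<and> e \<subseteq> M) \<or> (\<exists>r A U. L r M B A U)" for M B
  \<comment> \<open>Either an edge is completed or, after finitely many demotions of
    \<open>A\<close> to the role of \<open>U\<close>, there are \<open>m\<close> edges for Maker's
    next turn.\<close>
  have norm: "(\<exists>e\<in>E. e \<inter> B = {} \<and> e \<subseteq> M) \<or> (\<exists>r A U. L r M B A U \<and> card U \<ge> m)"
    if "L r M B A U" for r M B A U
    using that
  proof (induction r arbitrary: A U)
    case (0 A U)
    show ?case
    proof (cases "card U \<ge> m")
      case False
      have "A \<noteq> {}" using 0 False by (auto simp: L_def)
      then obtain e where e: "e \<in> A" by blast
      then have "e \<in> E" "e \<inter> B = {}" "card (e - M) = 0" using 0 D by (auto simp: L_def)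
      moreover from this have "finite e" using EV fin by (meson PowD finite_subset subsetD)
      ultimately show ?thesis by (auto simp: card_eq_0_iff)
    qed (use 0 in blast)
  next
    case (Suc r A U)
    show ?case
    proof (cases "card U \<ge> m")
      case False
      \<comment> \<open>Integrality: fewer than \<open>m \<le> m + b\<close> edges in
        \<open>U\<close> cannot make up a whole factor \<open>m + b\<close>, so \<open>A\<close>
        alone satisfies the bound with one power less.\<close>
      have "(m + b) ^ Suc r \<le> card A"
      proof (rule ccontr)
        assume "\<not> ?thesis"
        then have "card A + 1 \<le> (m + b) ^ Suc r" by simp
        then have "(m + b) * (card A + 1) \<le> (m + b) ^ Suc (Suc r)"
          unfolding power_Suc[of _ "Suc r"] by (rule mult_le_mono2)
        with Suc.prems False show False by (auto simp: L_def)
      qed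
      with Suc.prems have "L r M B {} A" by (auto simp: L_def)
      then show ?thesis by (rule Suc.IH)
    qed (use Suc.prems in blast)
  qed
  show ?thesis
  proof (rule Maker_winsI[where I = I, OF fin EV], goal_cases)
    case 1
    have "L (s - 1) {} {} {} D" using s1 cD s by (auto simp: L_def)
    then show ?case unfolding I_def by metis
  next
    case (2 M B)
    have finU: "finite (V - M - B)" using fin by simp
    show ?case
    proof (cases "\<exists>e\<in>E. e \<inter> B = {} \<and> e \<subseteq> M")
      case True
      then obtain e where e: "e \<in> E" "e \<inter> B = {}" "e \<subseteq> M" by blast
      obtain X where X: "X \<subseteq> V - M - B" "card X = min m (card (V - M - B))"
        using ex_move_between[OF finU, of "{}" m] by auto
      have "I (M \<union> X) (B \<union> Y)" if "Y \<subseteq> V - M - B - X" for Y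
        unfolding I_def using e that by (intro disjI1 bexI[of _ e]) auto
      with X show ?thesis by metis
    next
      case False
      with 2(3) norm obtain r A U where L: "L r M B A U" and U: "card U \<ge> m"
        unfolding I_def by metis
      obtain U1 where U1: "U1 \<subseteq> U" "card U1 = m" using obtain_subset_with_card_n[OF U] by metis
      have subD: "A \<subseteq> D" "U \<subseteq> D" using L by (auto simp: L_def)
      have fins: "finite A" "finite U" "finite U1" using finD subD U1 by (meson finite_subset)+
      have live: "e \<in> E \<and> e \<inter> B = {}" if "e \<in> A \<union> U" for e
        using that L D by (auto simp: L_def)
      have "\<exists>x. x \<in> e - M" if "e \<in> U" for e
        using False live[of e] that by blast
      then obtain x where x: "\<And>e. e \<in> U \<Longrightarrow> x e \<in> e - M" by metis
      have inj: "inj_on x U1"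
      proof
        fix e f assume "e \<in> U1" "f \<in> U1" "x e = x f"
        with x[of e] x[of f] U1 subD have "e \<in> D" "f \<in> D" "e \<inter> f \<noteq> {}" by auto
        with D show "e = f" by (auto simp: disjoint_def)
      qed
      define X where "X = x ` U1"
      have cX: "card X = m" using inj U1 by (simp add: X_def card_image)
      have XV: "X \<subseteq> V - M - B"
      proof
        fix v assume "v \<in> X"
        then obtain e where "e \<in> U" "v = x e" using U1 by (auto simp: X_def)
        moreover from this have "e \<inter> B = {}" "e \<subseteq> V" using live[of e] EV by auto
        ultimately show "v \<in> V - M - B" using x[of e] by blast
      qed
      have "I (M \<union> X) (B \<union> Y)" if Y: "Y \<subseteq> V - M - B - X" "card Y \<le> b" for Y
      proof -
        define K where "K = {e \<in> D. e \<inter> Y \<noteq> {}}"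
        have finY: "finite Y" using Y fin by (meson finite_Diff finite_subset)
        have "\<forall>e\<in>K. \<exists>y. y \<in> e \<inter> Y" by (auto simp: K_def)
        then obtain y where y: "\<And>e. e \<in> K \<Longrightarrow> y e \<in> e \<inter> Y" by metis
        \<comment> \<open>Edges of \<open>D\<close> are disjoint, so each vertex of \<open>Y\<close>
          destroys at most one of them and \<open>card K \<le> b\<close>.\<close>
        have "inj_on y K"
        proof
          fix e f assume "e \<in> K" "f \<in> K" "y e = y f"
          with y[of e] y[of f] have "e \<in> D" "f \<in> D" "e \<inter> f \<noteq> {}" by (auto simp: K_def)
          with D show "e = f" by (auto simp: disjoint_def)
        qed
        then have cK: "card K \<le> b" using card_inj_on_le[of y K Y] y finY Y by fastforce
        have finK: "finite K" using finD by (simp add: K_def)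
        define A' where "A' = (A \<union> U1) - K"
        define U' where "U' = (U - U1) - K"
        define k1 where "k1 = card (K \<inter> (A \<union> U1))"
        define k2 where "k2 = card (K \<inter> (U - U1))"
        have disj: "A \<inter> U1 = {}" "A \<inter> U = {}" using L U1 by (auto simp: L_def)
        have "k1 + k2 = card (K \<inter> (A \<union> U1) \<union> K \<inter> (U - U1))"
          unfolding k1_def k2_def using disj finK by (intro card_Un_disjoint[symmetric]) auto
        also have "\<dots> \<le> card K" using finK by (intro card_mono) auto
        finally have k: "k1 + k2 \<le> b" using cK by linarith
        have cA: "card A' + k1 = card A + m"
        proof -
          have "card A' = card (A \<union> U1) - k1"
            unfolding A'_def k1_def using fins
            by (subst card_Diff_subset_Int) (auto simp: Int_commute)
          moreover have "k1 \<le> card (A \<union> U1)" unfolding k1_def using fins by (intro card_mono) auto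
          moreover have "card (A \<union> U1) = card A + m" using fins disj U1 by (simp add: card_Un_disjoint)
          ultimately show ?thesis by simp
        qed
        have cU: "card U' + k2 + m = card U"
        proof -
          have "card U' = card (U - U1) - k2"
            unfolding U'_def k2_def using fins
            by (subst card_Diff_subset_Int) (auto simp: Int_commute)
          moreover have "k2 \<le> card (U - U1)" unfolding k2_def using fins by (intro card_mono) auto
          moreover have "card (U - U1) = card U - m" using fins U1 by (simp add: card_Diff_subset)
          ultimately show ?thesis using U by simp
        qed
        \<comment> \<open>\<open>U\<close> loses \<open>m + k2\<close> edges while \<open>A\<close>
          gains \<open>m - k1 \<ge> 1 + k2\<close> of them, because
          \<open>k1 + k2 \<le> b < m\<close>. At weight \<open>m + b\<close> per edge the gain
          outweighs the loss.\<close>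
        have "card U + (m + b) * card A \<le> card U' + (m + b) * card A'"
        proof -
          have "card A' \<ge> card A + 1 + k2" using cA k bm by linarith
          then have "(m + b) * card A' \<ge> (m + b) * (card A + 1 + k2)" by (rule mult_le_mono2)
          moreover have "(m + b) * k2 \<ge> k2" using bm by (cases "m + b") auto
          ultimately show ?thesis using cU by (simp add: algebra_simps)
        qed
        then have "(m + b) ^ Suc r \<le> card U' + (m + b) * card A'" using L by (simp add: L_def)
        moreover have "card (e - (M \<union> X)) \<le> r" if "e \<in> A'" for e
        proof (cases "e \<in> A")
          case True
          have "finite e" using True subD D EV fin by (meson PowD finite_subset subsetD)
          then have "card (e - (M \<union> X)) \<le> card (e - M)" by (intro card_mono) auto
          then show ?thesis using L True by (auto simp: L_def)
        next
          case False
          with that have eU1: "e \<in> U1" by (auto simp: A'_def)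
          then have "finite e" using U1 subD D EV fin by (meson PowD finite_subset subsetD)
          moreover have "e - (M \<union> X) \<subset> e - M" using x[of e] eU1 U1 by (auto simp: X_def)
          ultimately have "card (e - (M \<union> X)) < card (e - M)" by (intro psubset_card_mono) auto
          moreover have "card (e - M) \<le> Suc r" using L eU1 U1 by (auto simp: L_def)
          ultimately show ?thesis by simp
        qed
        moreover have "card (e - (M \<union> X)) \<le> Suc r" if "e \<in> U'" for e
        proof -
          have "e \<in> U" using that by (auto simp: U'_def)
          moreover from this have "finite e" using subD D EV fin by (meson PowD finite_subset subsetD)
          moreover from this have "card (e - (M \<union> X)) \<le> card (e - M)" by (intro card_mono) auto
          ultimately show ?thesis using L by (fastforce simp: L_def)
        qed
        moreover have "e \<inter> (B \<union> Y) = {}" if "e \<in> A' \<union> U'" for e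
        proof -
          have "e \<in> A \<union> U" "e \<notin> K" using that U1 by (auto simp: A'_def U'_def)
          then show ?thesis using L by (auto simp: L_def K_def)
        qed
        moreover have "A' \<union> U' \<subseteq> D" "A' \<inter> U' = {}"
          using subD U1 disj by (auto simp: A'_def U'_def)
        ultimately have "L r (M \<union> X) (B \<union> Y) A' U'" unfolding L_def by simp
        then show ?thesis unfolding I_def by metis
      qed
      moreover have "card X = min m (card (V - M - B))"
        using card_mono[OF finU XV] cX by simp
      ultimately show ?thesis using XV by metis
    qed
  next
    case (3 M B)
    then consider "\<exists>e\<in>E. e \<inter> B = {}" | r A U where "L r M B A U" unfolding I_def by blast
    then show ?case
    proof cases
      case (2 r A U)
      have "(m + b) ^ Suc r > 0" using bm by simp
      with 2 have "A \<union> U \<noteq> {}" unfolding L_def by (metis Un_empty add.right_neutral card.empty mult_0_right not_less)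
      then show ?thesis using 2 D by (fastforce simp: L_def)
    qed
  qed
qed

lemma sum_UN_le_nat:
  fixes f :: "'a \<Rightarrow> nat"
  assumes "finite Y" "\<And>y. y \<in> Y \<Longrightarrow> finite (A y)"
  shows "sum f (\<Union>y\<in>Y. A y) \<le> (\<Sum>y\<in>Y. sum f (A y))"
  using assms
proof (induction rule: finite_induct)
  case (insert y Y)
  then have "sum f (A y \<union> (\<Union>y\<in>Y. A y)) \<le> sum f (A y) + sum f (\<Union>y\<in>Y. A y)"
    by (subst sum_Un_nat) auto
  with insert show ?case by fastforce
qed simp

text \<open>Beck's weight function: an edge that Breaker has not hit weighs
  \<open>(b + 1) ^ j\<close> when Maker owns \<open>j\<close> of its vertices, so Maker's pick at a vertex of maximal weight
  pays for everything Breaker can hit, except for edges meeting both picks.\<close>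

lemma Maker_wins_potential:
  fixes \<Delta> :: nat
  assumes fin: "finite V" and EV: "E \<subseteq> Pow V" and m: "m \<ge> 1"
    and s: "\<And>e. e \<in> E \<Longrightarrow> card e \<le> s"
    and codeg: "\<And>x y. x \<noteq> y \<Longrightarrow> card {e \<in> E. x \<in> e \<and> y \<in> e} \<le> \<Delta>"
    and cE: "card E > b * (b * \<Delta> * (b + 1) ^ s) * card V"
  shows "has_winning_strategy m b Maker (V, E)"
proof -
  have finE: "finite E" using fin EV by (meson finite_Pow_iff finite_subset)
  have fe: "finite e" if "e \<in> E" for e using that EV fin by (meson PowD finite_subset subsetD)
  define W where "W M e = (b + 1) ^ card (e \<inter> M)" for M e :: "'a set"
  define alive where "alive B = {e \<in> E. e \<inter> B = {}}" for B
  \<comment> \<open>A bound for the net loss of weight in one round. Each round consumes at least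
    the vertex \<open>x\<close>, so a budget of \<open>c\<close> for every free vertex lasts to the
    end.\<close>
  define c where "c = b * (b * \<Delta> * (b + 1) ^ s)"
  define I where "I M B \<longleftrightarrow> c * card (V - M - B) < (\<Sum>e\<in>alive B. W M e)" for M B
  have fal: "finite (alive B)" for B using finE by (simp add: alive_def)
  show ?thesis
  proof (rule Maker_winsI[where I = I, OF fin EV], goal_cases)
    case 1
    have "alive {} = E" by (simp add: alive_def)
    then show ?case using cE by (simp add: I_def W_def c_def)
  next
    case (2 M B)
    define U where "U = V - M - B"
    have finU: "finite U" using fin by (simp add: U_def)
    define w where "w v = (\<Sum>e | e \<in> alive B \<and> v \<in> e. W M e)" for v
    obtain x where x: "x \<in> U" "\<And>y. y \<in> U \<Longrightarrow> w y \<le> w x"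
    proof -
      have "Max (w ` U) \<in> w ` U" using finU 2(4) by (intro Max_in) (auto simp: U_def)
      then obtain x where "x \<in> U" "w x = Max (w ` U)" by auto
      then show thesis using that[of x] finU by auto
    qed
    obtain X where X: "{x} \<subseteq> X" "X \<subseteq> U" "card X = min m (card U)"
      using ex_move_between[OF finU, of "{x}" m] x(1) m by auto
    have "I (M \<union> X) (B \<union> Y)" if Y: "Y \<subseteq> U - X" "card Y \<le> b" for Y
    proof -
      have finY: "finite Y" using Y finU by (meson finite_Diff finite_subset)
      \<comment> \<open>Accounting per edge: an unhit edge through \<open>x\<close> grows by a
        factor of at least \<open>b + 1\<close> and so gains at least \<open>b\<close> times its
        weight; a hit edge is lost; the last term takes back the gain credited to edges through
        \<open>x\<close> that are hit. Maker's other picks can only increase weights.\<close>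
      have pt: "W M e + b * (if x \<in> e then W M e else 0)
          \<le> (if e \<inter> Y = {} then W (M \<union> X) e else 0) + (if e \<inter> Y \<noteq> {} then W M e else 0)
            + b * (if x \<in> e \<and> e \<inter> Y \<noteq> {} then W M e else 0)" if "e \<in> alive B" for e
      proof (cases "e \<inter> Y = {}")
        case True
        have e: "finite e" using that fe by (simp add: alive_def)
        have "W M e + b * (if x \<in> e then W M e else 0) \<le> W (M \<union> X) e"
        proof (cases "x \<in> e")
          case True
          have "e \<inter> M \<subset> e \<inter> (M \<union> X)" using True X(1) x(1) by (auto simp: U_def)
          then have "card (e \<inter> M) < card (e \<inter> (M \<union> X))" using e by (intro psubset_card_mono) auto
          then have "(b + 1) ^ Suc (card (e \<inter> M)) \<le> (b + 1) ^ card (e \<inter> (M \<union> X))"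
            by (intro power_increasing) auto
          then show ?thesis using True by (simp add: W_def)
        next
          case False
          have "card (e \<inter> M) \<le> card (e \<inter> (M \<union> X))" using e by (intro card_mono) auto
          then show ?thesis using False by (auto simp: W_def intro!: power_increasing)
        qed
        with True show ?thesis by simp
      qed auto
      have "(\<Sum>e\<in>alive B. W M e) + b * w x \<le>
          (\<Sum>e | e \<in> alive B \<and> e \<inter> Y = {}. W (M \<union> X) e) + (\<Sum>e | e \<in> alive B \<and> e \<inter> Y \<noteq> {}. W M e)
          + b * (\<Sum>e | e \<in> alive B \<and> x \<in> e \<and> e \<inter> Y \<noteq> {}. W M e)"
        using sum_mono[OF pt, of "alive B" "\<lambda>e. e"] fal[of B]
        by (simp add: sum.distrib sum_distrib_left[symmetric] w_def sum.inter_filter[symmetric])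
      \<comment> \<open>Maximality of \<open>x\<close>: each of the at most \<open>b\<close>
        vertices of \<open>Y\<close> destroys weight at most \<open>w x\<close>, so the gain
        \<open>b * w x\<close> covers the loss.\<close>
      moreover have "(\<Sum>e | e \<in> alive B \<and> e \<inter> Y \<noteq> {}. W M e) \<le> b * w x"
      proof -
        have "(\<Sum>e | e \<in> alive B \<and> e \<inter> Y \<noteq> {}. W M e) \<le> (\<Sum>e\<in>(\<Union>y\<in>Y. {e \<in> alive B. y \<in> e}). W M e)"
          using finY fal by (intro sum_mono2) auto
        also have "\<dots> \<le> (\<Sum>y\<in>Y. w y)"
          unfolding w_def by (rule sum_UN_le_nat) (use finY fal in auto)
        also have "\<dots> \<le> (\<Sum>y\<in>Y. w x)" using Y x(2) by (intro sum_mono) auto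
        also have "\<dots> \<le> b * w x" using Y by simp
        finally show ?thesis .
      qed
      moreover have "(\<Sum>e | e \<in> alive B \<and> x \<in> e \<and> e \<inter> Y \<noteq> {}. W M e) \<le> b * \<Delta> * (b + 1) ^ s"
      proof -
        let ?T = "{e \<in> alive B. x \<in> e \<and> e \<inter> Y \<noteq> {}}"
        have "(\<Sum>e\<in>?T. W M e) \<le> (\<Sum>e\<in>?T. (b + 1) ^ s)"
        proof (rule sum_mono)
          fix e assume "e \<in> ?T"
          then have "e \<in> E" by (auto simp: alive_def)
          then have "card (e \<inter> M) \<le> s" using s fe by (meson card_mono inf_le1 le_trans)
          then show "W M e \<le> (b + 1) ^ s" unfolding W_def by (intro power_increasing) auto
        qed
        also have "\<dots> = card ?T * (b + 1) ^ s" by simp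
        also have "card ?T \<le> card (\<Union>y\<in>Y. {e \<in> E. x \<in> e \<and> y \<in> e})"
          using finY finE by (intro card_mono) (auto simp: alive_def)
        also have "\<dots> \<le> (\<Sum>y\<in>Y. card {e \<in> E. x \<in> e \<and> y \<in> e})" by (rule card_UN_le[OF finY])
        also have "\<dots> \<le> (\<Sum>y\<in>Y. \<Delta>)" using Y(1) X(1) by (intro sum_mono codeg) auto
        also have "\<dots> \<le> b * \<Delta>" using Y by simp
        finally show ?thesis by (simp add: mult_le_mono1)
      qed
      ultimately have "(\<Sum>e\<in>alive B. W M e) \<le> (\<Sum>e | e \<in> alive B \<and> e \<inter> Y = {}. W (M \<union> X) e) + c"
        unfolding c_def by (smt (verit) add.assoc add.commute add_le_cancel_right add_le_mono le_trans mult_le_mono2)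
      moreover have "{e \<in> alive B. e \<inter> Y = {}} = alive (B \<union> Y)" by (auto simp: alive_def)
      moreover have "c * card (V - (M \<union> X) - (B \<union> Y)) + c \<le> c * card U"
      proof -
        have "V - (M \<union> X) - (B \<union> Y) \<subset> U" using x(1) X(1) by (auto simp: U_def)
        then have "card (V - (M \<union> X) - (B \<union> Y)) < card U" using finU by (intro psubset_card_mono)
        then have "c * (card (V - (M \<union> X) - (B \<union> Y)) + 1) \<le> c * card U" by (intro mult_le_mono2) simp
        then show ?thesis by simp
      qed
      ultimately show ?thesis using 2(3) unfolding I_def U_def[symmetric] by simp
    qed
    with X show ?case unfolding U_def by metis
  next
    case (3 M B)
    then have "alive B \<noteq> {}" by (auto simp: I_def)
    then show ?case by (auto simp: alive_def)
  qed
qed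

section \<open>Hall's theorem\<close>

text \<open>Rado's argument: as long as some set has two elements, one of them can be removed without
  violating Hall's condition.\<close>

theorem hall_marriage:
  fixes A :: "'i \<Rightarrow> 'a set"
  assumes "finite I" "\<And>i. i \<in> I \<Longrightarrow> finite (A i)"
    and "\<And>J. J \<subseteq> I \<Longrightarrow> card J \<le> card (\<Union>(A ` J))"
  shows "\<exists>f. inj_on f I \<and> (\<forall>i\<in>I. f i \<in> A i)"
  using assms
proof (induction "\<Sum>i\<in>I. card (A i)" arbitrary: A rule: less_induct)
  case (less A)
  note finI = less.prems(1) and finA = less.prems(2) and hall = less.prems(3)
  have ge1: "card (A i) \<ge> 1" if "i \<in> I" for i
    using hall[of "{i}"] that by simp
  have finUN: "finite (\<Union>(A ` J))" if "J \<subseteq> I" for J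
    using that finI finA by (auto intro: finite_subset)
  show ?case
  proof (cases "\<exists>i\<in>I. card (A i) \<ge> 2")
    case False
    then have "card (A i) = 1" if "i \<in> I" for i using ge1[OF that] that by fastforce
    then have "\<exists>x. A i = {x}" if "i \<in> I" for i using that by (simp add: card_1_singleton_iff)
    then obtain f where f: "\<And>i. i \<in> I \<Longrightarrow> A i = {f i}" by metis
    have "inj_on f I"
    proof (rule inj_onI, rule ccontr)
      fix i j assume "i \<in> I" "j \<in> I" "f i = f j" "i \<noteq> j"
      with hall[of "{i, j}"] f[of i] f[of j] show False by simp
    qed
    with f show ?thesis by auto
  next
    case True
    then obtain i where i: "i \<in> I" "card (A i) \<ge> 2" by blast
    obtain x y where xy: "x \<in> A i" "y \<in> A i" "x \<noteq> y"
      using i(2) card_le_Suc0_iff_eq[OF finA[OF i(1)]] by fastforce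
    define B where "B z = A(i := A i - {z})" for z
    have shrink: "(\<Sum>j\<in>I. card (B z j)) < (\<Sum>j\<in>I. card (A j))" if "z \<in> A i" for z
    proof (rule sum_strict_mono_ex1[OF finI])
      show "\<forall>j\<in>I. card (B z j) \<le> card (A j)"
        using finA by (auto simp: B_def intro: card_mono)
      show "\<exists>j\<in>I. card (B z j) < card (A j)"
        using i(1) card_Diff1_less[OF finA[OF i(1)] that] by (intro bexI[of _ i]) (simp_all add: B_def)
    qed
    have finB: "finite (B z j)" if "j \<in> I" for z j using finA that by (auto simp: B_def)
    have BA: "B z j \<subseteq> A j" for z j by (auto simp: B_def)
    have IH: "\<exists>f. inj_on f I \<and> (\<forall>i\<in>I. f i \<in> A i)" if "z \<in> A i" "\<And>J. J \<subseteq> I \<Longrightarrow> card J \<le> card (\<Union>(B z ` J))" for z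
    proof -
      from less.hyps[OF shrink[OF that(1)] finI finB that(2)]
      obtain f where "inj_on f I" "\<forall>j\<in>I. f j \<in> B z j" by blast
      then show ?thesis using BA by blast
    qed
    \<comment> \<open>Only families containing \<open>i\<close> are affected by the removal of
      \<open>z\<close>. Splitting off \<open>i\<close> leaves a family \<open>J\<close> whose union,
      even enlarged by \<open>A i - {z}\<close>, has at most \<open>card J\<close> elements.\<close>
    have viol: "\<exists>J\<subseteq>I - {i}. card (\<Union>(A ` J) \<union> (A i - {z})) \<le> card J"
      if "J \<subseteq> I" "\<not> card J \<le> card (\<Union>(B z ` J))" for z J
    proof -
      have "i \<in> J"
      proof (rule ccontr)
        assume "i \<notin> J"
        then have "B z ` J = A ` J" by (auto simp: B_def)
        with hall[OF that(1)] that(2) show False by simp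
      qed
      then have "\<Union>(B z ` J) = \<Union>(A ` (J - {i})) \<union> (A i - {z})"
        by (auto simp: B_def split: if_splits)
      moreover have "card (J - {i}) = card J - 1" using \<open>i \<in> J\<close> by simp
      ultimately have "card (\<Union>(A ` (J - {i})) \<union> (A i - {z})) \<le> card (J - {i})" using that(2) by simp
      then show ?thesis using that(1) by (intro exI[of _ "J - {i}"]) auto
    qed
    show ?thesis
    proof (rule ccontr)
      assume no: "\<not> ?thesis"
      obtain J where J: "J \<subseteq> I - {i}" "card (\<Union>(A ` J) \<union> (A i - {x})) \<le> card J"
        using IH[OF xy(1)] viol[of _ x] no by metis
      obtain K where K: "K \<subseteq> I - {i}" "card (\<Union>(A ` K) \<union> (A i - {y})) \<le> card K"
        using IH[OF xy(2)] viol[of _ y] no by metis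
      \<comment> \<open>Uncrossing: \<open>?P \<union> ?Q\<close> contains all of \<open>A i\<close>
        since \<open>x \<noteq> y\<close>. Hall's condition for
        \<open>insert i (J \<union> K)\<close> and for \<open>J \<inter> K\<close> together then
        demands one element more than \<open>?P\<close> and \<open>?Q\<close> can supply.\<close>
      let ?P = "\<Union>(A ` J) \<union> (A i - {x})" and ?Q = "\<Union>(A ` K) \<union> (A i - {y})"
      have fins: "finite J" "finite K" "finite ?P" "finite ?Q"
        using J(1) K(1) finI finUN[of J] finUN[of K] finA[OF i(1)] by (auto intro: finite_subset)
      have "card (J \<union> K) + 1 = card (insert i (J \<union> K))"
        using J(1) K(1) fins by (subst card_insert_disjoint) auto
      also have "\<dots> \<le> card (\<Union>(A ` insert i (J \<union> K)))" using J K i by (intro hall) auto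
      also have "\<Union>(A ` insert i (J \<union> K)) = ?P \<union> ?Q" using xy by auto
      finally have 1: "card (J \<union> K) + 1 \<le> card (?P \<union> ?Q)" .
      have "card (J \<inter> K) \<le> card (\<Union>(A ` (J \<inter> K)))" using J by (intro hall) auto
      also have "\<dots> \<le> card (?P \<inter> ?Q)" using fins by (intro card_mono) auto
      finally have 2: "card (J \<inter> K) \<le> card (?P \<inter> ?Q)" .
      have "card ?P + card ?Q = card (?P \<union> ?Q) + card (?P \<inter> ?Q)" using fins by (intro card_Un_Int)
      moreover have "card J + card K = card (J \<union> K) + card (J \<inter> K)" using fins by (intro card_Un_Int)
      ultimately show False using 1 2 J(2) K(2) by linarith
    qed
  qed
qed

text \<open>Hall's theorem for \<open>d\<close> copies of each edge: a set of copies has at most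
  \<open>d\<close> times as many members as its projection to edges, so the hypothesis on edge sets
  suffices. Injectivity makes the chosen parts disjoint.\<close>

lemma hall_disjoint_subsets:
  assumes fin: "finite E" "\<And>e. e \<in> E \<Longrightarrow> finite e"
    and hall: "\<And>F. F \<subseteq> E \<Longrightarrow> d * card F \<le> card (\<Union>F)"
  shows "\<exists>g. (\<forall>e\<in>E. g e \<subseteq> e \<and> card (g e) = d) \<and> (\<forall>e\<in>E. \<forall>f\<in>E. e \<noteq> f \<longrightarrow> g e \<inter> g f = {})"
proof -
  have "\<exists>f. inj_on f (E \<times> {..<d}) \<and> (\<forall>i\<in>E \<times> {..<d}. f i \<in> fst i)"
  proof (rule hall_marriage)
    fix J assume J: "J \<subseteq> E \<times> {..<d}"
    then have "J \<subseteq> fst ` J \<times> {..<d}" by (auto simp: image_iff) force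
    moreover have "finite (fst ` J)" using J fin(1) by (intro finite_subset[of "fst ` J" E]) auto
    then have "finite (fst ` J \<times> {..<d})" by simp
    ultimately have "card J \<le> card (fst ` J \<times> {..<d})" by (intro card_mono)
    also have "\<dots> = d * card (fst ` J)" by (simp add: card_cartesian_product)
    also have "\<dots> \<le> card (\<Union>(fst ` J))" using J by (intro hall) auto
    finally show "card J \<le> card (\<Union>(fst ` J))" .
  qed (use fin in auto)
  then obtain f where f: "inj_on f (E \<times> {..<d})" "\<And>e j. e \<in> E \<Longrightarrow> j < d \<Longrightarrow> f (e, j) \<in> e" by fastforce
  define g where "g e = f ` ({e} \<times> {..<d})" for e
  have "g e \<subseteq> e \<and> card (g e) = d" if "e \<in> E" for e
  proof -
    have "inj_on f ({e} \<times> {..<d})" using f(1) by (rule inj_on_subset) (use that in auto)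
    then show ?thesis using f(2) that by (auto simp: g_def card_image card_cartesian_product)
  qed
  moreover have "g e \<inter> g e' = {}" if "e \<in> E" "e' \<in> E" "e \<noteq> e'" for e e'
    using f(1) that by (auto simp: g_def inj_on_def)
  ultimately show ?thesis by blast
qed

section \<open>Independent coin flips\<close>

text \<open>Cutting \<open>A\<close> and \<open>B\<close> down to the supports changes no
  probability and makes both sets countable, as the product rule requires.\<close>

lemma prob_pair_pmf_Times:
  "measure_pmf.prob (pair_pmf M N) (A \<times> B) = measure_pmf.prob M A * measure_pmf.prob N B"
proof -
  have "measure_pmf.prob (pair_pmf M N) (A \<times> B) =
      measure_pmf.prob (pair_pmf M N) ((A \<times> B) \<inter> set_pmf (pair_pmf M N))"
    by (rule measure_Int_set_pmf[symmetric])
  also have "(A \<times> B) \<inter> set_pmf (pair_pmf M N) = (A \<inter> set_pmf M) \<times> (B \<inter> set_pmf N)"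
    by auto
  also have "measure_pmf.prob (pair_pmf M N) \<dots> =
      measure_pmf.prob M (A \<inter> set_pmf M) * measure_pmf.prob N (B \<inter> set_pmf N)"
    by (intro measure_pmf_prob_product) (auto intro: countable_subset[OF _ countable_set_pmf])
  finally show ?thesis by (simp add: measure_Int_set_pmf)
qed

text \<open>Dependence on the coins in \<open>A\<close> alone is expressed as invariance under
  changes outside \<open>A\<close>. Splitting the coins at \<open>A\<close> turns the joint event
  into a rectangle in a product space.\<close>

lemma prob_Pi_pmf_conj:
  assumes fin: "finite E" and A: "A \<subseteq> E" "B \<subseteq> E" "A \<inter> B = {}"
    and P: "\<And>f g. (\<And>x. x \<in> A \<Longrightarrow> f x = g x) \<Longrightarrow> P f = P g"
    and Q: "\<And>f g. (\<And>x. x \<in> B \<Longrightarrow> f x = g x) \<Longrightarrow> Q f = Q g"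
  shows "measure_pmf.prob (Pi_pmf E d p) {f. P f \<and> Q f} =
    measure_pmf.prob (Pi_pmf E d p) {f. P f} * measure_pmf.prob (Pi_pmf E d p) {f. Q f}"
proof -
  define h where "h = (\<lambda>(f :: 'a \<Rightarrow> 'b, g) x. if x \<in> A then f x else g x)"
  have "Pi_pmf (A \<union> (E - A)) d p = map_pmf h (pair_pmf (Pi_pmf A d p) (Pi_pmf (E - A) d p))"
    unfolding h_def using fin A(1) by (intro Pi_pmf_union) (auto intro: finite_subset)
  then have eq: "Pi_pmf E d p = map_pmf h (pair_pmf (Pi_pmf A d p) (Pi_pmf (E - A) d p))"
    using A(1) by (simp add: Un_absorb1)
  have hP: "P (h (f, g)) = P f" for f g by (rule P) (simp add: h_def)
  have hQ: "Q (h (f, g)) = Q g" for f g by (rule Q) (use A in \<open>auto simp: h_def\<close>)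
  have "h -` {f. P f \<and> Q f} = {f. P f} \<times> {g. Q g}" using hP hQ by auto
  moreover have "h -` {f. P f} = {f. P f} \<times> UNIV" using hP by auto
  moreover have "h -` {f. Q f} = UNIV \<times> {g. Q g}" using hQ by auto
  ultimately show ?thesis unfolding eq measure_map_pmf by (simp add: prob_pair_pmf_Times)
qed

lemma prob_Pi_pmf_Ball:
  assumes fin: "finite E" "finite I" and F: "\<And>i. i \<in> I \<Longrightarrow> F i \<subseteq> E" "disjoint_family_on F I"
    and P: "\<And>i f g. i \<in> I \<Longrightarrow> (\<And>x. x \<in> F i \<Longrightarrow> f x = g x) \<Longrightarrow> P i f = P i g"
  shows "measure_pmf.prob (Pi_pmf E d p) {f. \<forall>i\<in>I. P i f} =
    (\<Prod>i\<in>I. measure_pmf.prob (Pi_pmf E d p) {f. P i f})"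
  using fin(2) F P
proof (induction I rule: finite_induct)
  case (insert i I)
  have "measure_pmf.prob (Pi_pmf E d p) {f. P i f \<and> (\<forall>j\<in>I. P j f)} =
      measure_pmf.prob (Pi_pmf E d p) {f. P i f} * measure_pmf.prob (Pi_pmf E d p) {f. \<forall>j\<in>I. P j f}"
  proof (rule prob_Pi_pmf_conj[OF fin(1), where A = "F i" and B = "\<Union>j\<in>I. F j"])
    show "F i \<inter> (\<Union>j\<in>I. F j) = {}"
      using insert.prems(2) insert.hyps(2) by (auto simp: disjoint_family_on_def)
    fix f g :: "'a \<Rightarrow> 'c" assume "\<And>x. x \<in> (\<Union>j\<in>I. F j) \<Longrightarrow> f x = g x"
    then have "P j f = P j g" if "j \<in> I" for j using insert.prems(3)[of j f g] that by blast
    then show "(\<forall>j\<in>I. P j f) = (\<forall>j\<in>I. P j g)" by blast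
  next
    show "F i \<subseteq> E" "(\<Union>j\<in>I. F j) \<subseteq> E" using insert.prems(1) by auto
    show "P i f = P i g" if "\<And>x. x \<in> F i \<Longrightarrow> f x = g x" for f g
      using insert.prems(3)[of i f g] that by simp
  qed
  moreover have "measure_pmf.prob (Pi_pmf E d p) {f. \<forall>j\<in>I. P j f} =
      (\<Prod>j\<in>I. measure_pmf.prob (Pi_pmf E d p) {f. P j f})"
  proof (rule insert.IH)
    show "disjoint_family_on F I"
      by (rule disjoint_family_on_mono[OF _ insert.prems(2)]) blast
    show "F j \<subseteq> E" if "j \<in> I" for j using insert.prems(1)[of j] that by simp
    show "P j f = P j g" if "j \<in> I" "\<And>x. x \<in> F j \<Longrightarrow> f x = g x" for j f g
      using insert.prems(3)[of j f g] that by simp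
  qed
  ultimately show ?case using insert.hyps by simp
qed simp

abbreviation coins :: "'a set \<Rightarrow> real \<Rightarrow> ('a \<Rightarrow> bool) pmf" where
  "coins E p \<equiv> Pi_pmf E False (\<lambda>_. bernoulli_pmf p)"

lemma prob_all_absent:
  assumes "finite E" "S \<subseteq> E" "0 \<le> p" "p \<le> 1"
  shows "measure_pmf.prob (coins E p) {f. \<forall>e\<in>S. \<not> f e} = (1 - p) ^ card S"
proof -
  have S: "finite S" using assms by (auto intro: finite_subset)
  have "measure_pmf.prob (coins E p) {f. \<forall>e\<in>S. \<not> f e} =
      (\<Prod>e\<in>S. measure_pmf.prob (coins E p) {f. \<not> f e})"
    using assms S by (intro prob_Pi_pmf_Ball[where F = "\<lambda>e. {e}"]) (auto simp: disjoint_family_on_def)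
  also have "\<dots> = (\<Prod>e\<in>S. 1 - p)"
  proof (rule prod.cong[OF refl])
    fix e assume "e \<in> S"
    then have "map_pmf (\<lambda>f. f e) (coins E p) = bernoulli_pmf p"
      using Pi_pmf_component[OF assms(1), of e False "\<lambda>_. bernoulli_pmf p"] assms(2) by auto
    moreover have "{f. \<not> f e} = (\<lambda>f. f e) -` {False}" by auto
    ultimately have "measure_pmf.prob (coins E p) {f. \<not> f e} = measure_pmf.prob (bernoulli_pmf p) {False}"
      by (metis measure_map_pmf)
    then show "measure_pmf.prob (coins E p) {f. \<not> f e} = 1 - p"
      using assms by (simp add: measure_pmf_single)
  qed
  finally show ?thesis by simp
qed

lemma prob_all_present:
  assumes "finite E" "S \<subseteq> E" "0 \<le> p" "p \<le> 1"
  shows "measure_pmf.prob (coins E p) {f. \<forall>e\<in>S. f e} = p ^ card S"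
proof -
  have S: "finite S" using assms by (auto intro: finite_subset)
  have "measure_pmf.prob (coins E p) {f. \<forall>e\<in>S. f e} =
      (\<Prod>e\<in>S. measure_pmf.prob (coins E p) {f. f e})"
    using assms S by (intro prob_Pi_pmf_Ball[where F = "\<lambda>e. {e}"]) (auto simp: disjoint_family_on_def)
  also have "\<dots> = (\<Prod>e\<in>S. p)"
  proof (rule prod.cong[OF refl])
    fix e assume "e \<in> S"
    then have "map_pmf (\<lambda>f. f e) (coins E p) = bernoulli_pmf p"
      using Pi_pmf_component[OF assms(1), of e False "\<lambda>_. bernoulli_pmf p"] assms(2) by auto
    moreover have "{f. f e} = (\<lambda>f. f e) -` {True}" by auto
    ultimately have "measure_pmf.prob (coins E p) {f. f e} = measure_pmf.prob (bernoulli_pmf p) {True}"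
      by (metis measure_map_pmf)
    then show "measure_pmf.prob (coins E p) {f. f e} = p"
      using assms by (simp add: measure_pmf_single)
  qed
  finally show ?thesis by simp
qed

lemma prob_some_all_present_le:
  assumes "finite E" "finite I" "\<And>i. i \<in> I \<Longrightarrow> G i \<subseteq> E" "0 \<le> p" "p \<le> 1"
  shows "measure_pmf.prob (coins E p) {f. \<exists>i\<in>I. \<forall>e\<in>G i. f e} \<le> (\<Sum>i\<in>I. p ^ card (G i))"
proof -
  have "{f. \<exists>i\<in>I. \<forall>e\<in>G i. f e} = (\<Union>i\<in>I. {f. \<forall>e\<in>G i. f e})" by auto
  also have "measure_pmf.prob (coins E p) \<dots> \<le> (\<Sum>i\<in>I. measure_pmf.prob (coins E p) {f. \<forall>e\<in>G i. f e})"
    using assms(2) by (intro measure_UNION_le) auto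
  also have "\<dots> = (\<Sum>i\<in>I. p ^ card (G i))"
    using assms by (intro sum.cong prob_all_present) auto
  finally show ?thesis .
qed

lemma one_minus_power_le_exp:
  fixes x :: real
  assumes "0 \<le> x" "x \<le> 1"
  shows "(1 - x) ^ n \<le> exp (- (real n * x))"
proof -
  have "(1 - x) ^ n \<le> exp (- x) ^ n"
    using assms exp_ge_add_one_self[of "- x"] by (intro power_mono) auto
  also have "\<dots> = exp (- (real n * x))" by (simp add: exp_of_nat_mult[symmetric])
  finally show ?thesis .
qed

text \<open>For stars: \<open>v\<close> is a candidate centre and \<open>F v j\<close> the potential
  edges for its \<open>j\<close>-th ray. Disjointness makes rays and centres independent, so a
  centre succeeds with probability exactly \<open>q ^ card J\<close> and the failure probabilities
  multiply.\<close>

lemma prob_no_star_le: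
  fixes F :: "'v \<Rightarrow> 'j \<Rightarrow> 'a set"
  assumes fin: "finite E" "finite C" "finite J" and p: "0 \<le> p" "p \<le> 1"
    and F: "\<And>v j. v \<in> C \<Longrightarrow> j \<in> J \<Longrightarrow> F v j \<subseteq> E \<and> card (F v j) = N"
    and disj: "disjoint_family_on (\<lambda>(v, j). F v j) (C \<times> J)"
  shows "measure_pmf.prob (coins E p) {f. \<forall>v\<in>C. \<not> (\<forall>j\<in>J. \<exists>e\<in>F v j. f e)}
    \<le> exp (- (real (card C) * (1 - (1 - p) ^ N) ^ card J))"
proof -
  let ?P = "measure_pmf.prob (coins E p)"
  define q where "q = 1 - (1 - p) ^ N"
  have q: "0 \<le> q" "q \<le> 1" using p by (auto simp: q_def power_le_one)
  have d: "F v j \<inter> F w i = {}" if "v \<in> C" "w \<in> C" "j \<in> J" "i \<in> J" "(v, j) \<noteq> (w, i)" for v w i j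
    using disj that unfolding disjoint_family_on_def by fastforce
  have star: "?P {f. \<not> (\<forall>j\<in>J. \<exists>e\<in>F v j. f e)} = 1 - q ^ card J" if v: "v \<in> C" for v
  proof -
    have "?P {f. \<forall>j\<in>J. \<exists>e\<in>F v j. f e} = (\<Prod>j\<in>J. ?P {f. \<exists>e\<in>F v j. f e})"
    proof (rule prob_Pi_pmf_Ball[OF fin(1,3), where F = "F v"])
      show "disjoint_family_on (F v) J" using d[OF v v] by (auto simp: disjoint_family_on_def)
    qed (use F v in auto)
    also have "\<dots> = (\<Prod>j\<in>J. q)"
    proof (rule prod.cong[OF refl])
      fix j assume j: "j \<in> J"
      have "?P {f. \<exists>e\<in>F v j. f e} = ?P (UNIV - {f. \<forall>e\<in>F v j. \<not> f e})" by (rule arg_cong[of _ _ ?P]) auto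
      also have "\<dots> = 1 - ?P {f. \<forall>e\<in>F v j. \<not> f e}"
        using measure_pmf.prob_compl[of "{f. \<forall>e\<in>F v j. \<not> f e}" "coins E p"] by simp
      finally show "?P {f. \<exists>e\<in>F v j. f e} = q"
        using prob_all_absent[OF fin(1), of "F v j" p] F[OF v j] p by (simp add: q_def)
    qed
    finally have "?P {f. \<forall>j\<in>J. \<exists>e\<in>F v j. f e} = q ^ card J" by simp
    moreover have "?P {f. \<not> (\<forall>j\<in>J. \<exists>e\<in>F v j. f e)} = 1 - ?P {f. \<forall>j\<in>J. \<exists>e\<in>F v j. f e}"
    proof -
      have "{f. \<not> (\<forall>j\<in>J. \<exists>e\<in>F v j. f e)} = UNIV - {f. \<forall>j\<in>J. \<exists>e\<in>F v j. f e}" by auto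
      then show ?thesis
        using measure_pmf.prob_compl[of "{f. \<forall>j\<in>J. \<exists>e\<in>F v j. f e}" "coins E p"] by simp
    qed
    ultimately show ?thesis by simp
  qed
  have "?P {f. \<forall>v\<in>C. \<not> (\<forall>j\<in>J. \<exists>e\<in>F v j. f e)} = (\<Prod>v\<in>C. ?P {f. \<not> (\<forall>j\<in>J. \<exists>e\<in>F v j. f e)})"
  proof (rule prob_Pi_pmf_Ball[OF fin(1,2), where F = "\<lambda>v. \<Union>j\<in>J. F v j"])
    show "disjoint_family_on (\<lambda>v. \<Union>j\<in>J. F v j) C"
      unfolding disjoint_family_on_def using d by blast
    fix v and f g :: "'a \<Rightarrow> bool"
    assume "\<And>x. x \<in> (\<Union>j\<in>J. F v j) \<Longrightarrow> f x = g x"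
    then show "(\<not> (\<forall>j\<in>J. \<exists>e\<in>F v j. f e)) = (\<not> (\<forall>j\<in>J. \<exists>e\<in>F v j. g e))" by fastforce
  qed (use F in blast)
  also have "\<dots> = (1 - q ^ card J) ^ card C" using star by simp
  also have "\<dots> \<le> exp (- (real (card C) * q ^ card J))"
    using q by (intro one_minus_power_le_exp) (auto simp: power_le_one)
  finally show ?thesis by (simp add: q_def)
qed

text \<open>Exponential Markov inequality: with \<open>X\<close> the number of kept edges, the
  expectation of \<open>(1 / 2) ^ X\<close> factors into
  \<open>(1 - p / 2) ^ card E\<close>.\<close>

lemma prob_few_present_le:
  assumes fin: "finite E" and p: "0 \<le> p" "p \<le> 1"
  shows "measure_pmf.prob (coins E p) {f. card {e \<in> E. f e} \<le> K} \<le> 2 ^ K * exp (- (real (card E) * p / 2))"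
proof -
  let ?X = "\<lambda>f. \<Prod>e\<in>E. if f e then 1 / 2 else 1 :: real"
  have X: "?X f = (1 / 2) ^ card {e \<in> E. f e}" for f :: "'a \<Rightarrow> bool"
    using fin by (simp add: prod.If_cases Int_def)
  have int: "integrable (coins E p) ?X"
    by (rule integrable_prod_Pi_pmf[OF fin]) (auto intro!: measure_pmf.integrable_const_bound[where B = 1])
  have "measure_pmf.prob (coins E p) {f. card {e \<in> E. f e} \<le> K} =
      measure_pmf.expectation (coins E p) (indicator {f. card {e \<in> E. f e} \<le> K})" by simp
  also have "\<dots> \<le> measure_pmf.expectation (coins E p) (\<lambda>f. 2 ^ K * ?X f)"
  proof (rule integral_mono)
    show "integrable (coins E p) (\<lambda>f. 2 ^ K * ?X f)" using int by (rule integrable_mult_right)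
    show "integrable (coins E p) (indicator {f. card {e \<in> E. f e} \<le> K} :: _ \<Rightarrow> real)"
      by (rule measure_pmf.integrable_const_bound[where B = 1]) auto
    fix f :: "'a \<Rightarrow> bool"
    have "1 \<le> 2 ^ K * ?X f" if "card {e \<in> E. f e} \<le> K"
    proof -
      have "(1 / 2 :: real) ^ K \<le> (1 / 2) ^ card {e \<in> E. f e}" using that by (intro power_decreasing) auto
      then have "2 ^ K * (1 / 2 :: real) ^ K \<le> 2 ^ K * ?X f" unfolding X by (intro mult_left_mono) auto
      then show ?thesis by (simp flip: power_mult_distrib)
    qed
    moreover have "0 \<le> 2 ^ K * ?X f" unfolding X by simp
    ultimately show "indicator {f. card {e \<in> E. f e} \<le> K} f \<le> 2 ^ K * ?X f"
      by (auto simp: indicator_def)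
  qed
  also have "\<dots> = 2 ^ K * measure_pmf.expectation (coins E p) ?X" by simp
  also have "measure_pmf.expectation (coins E p) ?X = (\<Prod>e\<in>E. 1 - p / 2)"
    using p by (subst expectation_prod_Pi_pmf[OF fin])
      (auto intro!: prod.cong measure_pmf.integrable_const_bound[where B = 1])
  also have "2 ^ K * \<dots> \<le> 2 ^ K * exp (- (real (card E) * p / 2))"
    using one_minus_power_le_exp[of "p / 2" "card E"] p by simp
  finally show ?thesis .
qed

text \<open>Coupling: a \<open>p'\<close>-coin is the conjunction of a \<open>p\<close>-coin and an
  independent coin of bias \<open>p' / p\<close>, so the sparser set sits inside the denser
  one.\<close>

lemma prob_coins_mono:
  assumes fin: "finite E" and p: "0 \<le> p'" "p' \<le> p" "p \<le> 1"
    and Q: "\<And>f g. (\<And>x. f x \<Longrightarrow> g x) \<Longrightarrow> Q f \<Longrightarrow> Q g"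
  shows "measure_pmf.prob (coins E p') {f. Q f} \<le> measure_pmf.prob (coins E p) {f. Q f}"
proof (cases "p = 0")
  case False
  define r where "r = p' / p"
  have r: "0 \<le> r" "r \<le> 1" "p * r = p'" using p False by (auto simp: r_def divide_le_eq_1)
  define B where "B = pair_pmf (bernoulli_pmf p) (bernoulli_pmf r)"
  have 1: "bernoulli_pmf p = map_pmf fst B" by (simp add: B_def map_fst_pair_pmf)
  have 2: "bernoulli_pmf p' = map_pmf (\<lambda>(x, y). x \<and> y) B"
  proof -
    have T: "pmf (map_pmf (\<lambda>(x, y). x \<and> y) B) True = p'"
    proof -
      have "(\<lambda>(x, y). x \<and> y) -` {True} = {(True, True)}" by auto
      then have "pmf (map_pmf (\<lambda>(x, y). x \<and> y) B) True = pmf B (True, True)"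
        by (simp add: pmf_map measure_pmf_single)
      then show ?thesis using p r by (simp add: B_def pmf_pair)
    qed
    show ?thesis
    proof (rule pmf_eqI)
      fix i show "pmf (bernoulli_pmf p') i = pmf (map_pmf (\<lambda>(x, y). x \<and> y) B) i"
        using T p by (cases i) (auto simp: pmf_False_conv_True)
    qed
  qed
  define M where "M = Pi_pmf E (False, False) (\<lambda>_. B)"
  have "coins E p = map_pmf (\<lambda>h. fst \<circ> h) M" unfolding 1 M_def by (rule Pi_pmf_map[OF fin]) simp
  moreover have "coins E p' = map_pmf (\<lambda>h. (\<lambda>(x, y). x \<and> y) \<circ> h) M"
    unfolding 2 M_def by (rule Pi_pmf_map[OF fin]) simp
  moreover have "measure_pmf.prob M {h. Q ((\<lambda>(x, y). x \<and> y) \<circ> h)} \<le> measure_pmf.prob M {h. Q (fst \<circ> h)}"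
  proof (rule measure_pmf.finite_measure_mono)
    show "{h. Q ((\<lambda>(x, y). x \<and> y) \<circ> h)} \<subseteq> {h. Q (fst \<circ> h)}"
      by (auto elim!: Q[rotated] split: prod.splits)
  qed simp
  ultimately show ?thesis by (simp add: vimage_def)
qed (use p in auto)

section \<open>Random hypergraphs\<close>

abbreviation slots :: "nat \<Rightarrow> nat \<Rightarrow> nat set set" where
  "slots n s \<equiv> {e. e \<subseteq> {..<n} \<and> card e = s}"

abbreviation kept_hypergraph :: "nat \<Rightarrow> nat \<Rightarrow> (nat set \<Rightarrow> bool) \<Rightarrow> nat hypergraph" where
  "kept_hypergraph n s f \<equiv> ({..<n}, {e \<in> slots n s. f e})"

lemma finite_slots [simp]: "finite (slots n s)"
  by (rule finite_subset[of _ "Pow {..<n}"]) auto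

lemma whp_iff_coins:
  "whp s p Q \<longleftrightarrow>
     (\<lambda>n. measure_pmf.prob (coins (slots n s) (p n)) {f. Q (kept_hypergraph n s f)}) \<longlonglongrightarrow> 1"
  by (simp add: whp_def random_hypergraph_def complete_uniform_def vimage_def)

lemma whpI:
  assumes le: "\<forall>\<^sub>F n in sequentially.
      measure_pmf.prob (coins (slots n s) (p n)) {f. \<not> Q (kept_hypergraph n s f)} \<le> \<epsilon> n"
    and \<epsilon>: "\<epsilon> \<longlonglongrightarrow> 0"
  shows "whp s p Q"
  unfolding whp_iff_coins
proof (rule tendsto_sandwich)
  show "(\<lambda>n. 1 - \<epsilon> n) \<longlonglongrightarrow> 1" using tendsto_diff[OF tendsto_const \<epsilon>, of 1] by simp
  show "\<forall>\<^sub>F n in sequentially. 1 - \<epsilon> n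
      \<le> measure_pmf.prob (coins (slots n s) (p n)) {f. Q (kept_hypergraph n s f)}"
    using le
  proof eventually_elim
    case (elim n)
    have "{f. \<not> Q (kept_hypergraph n s f)} = UNIV - {f. Q (kept_hypergraph n s f)}" by auto
    then show ?case
      using elim measure_pmf.prob_compl[of "{f. Q (kept_hypergraph n s f)}" "coins (slots n s) (p n)"]
      by simp
  qed
qed auto

lemma prob_coins_le:
  assumes "\<And>f. P f \<Longrightarrow> R f" and "measure_pmf.prob (coins E p) {f. R f} \<le> c"
  shows "measure_pmf.prob (coins E p) {f. P f} \<le> c"
proof -
  have "measure_pmf.prob (coins E p) {f. P f} \<le> measure_pmf.prob (coins E p) {f. R f}"
    using assms(1) by (intro measure_pmf.finite_measure_mono) auto
  with assms(2) show ?thesis by linarith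
qed

lemma whp_mono:
  assumes "whp s p Q" and "\<And>n f. Q (kept_hypergraph n s f) \<Longrightarrow> R (kept_hypergraph n s f)"
  shows "whp s p R"
  unfolding whp_iff_coins
proof (rule tendsto_sandwich)
  show "(\<lambda>n. measure_pmf.prob (coins (slots n s) (p n)) {f. Q (kept_hypergraph n s f)}) \<longlonglongrightarrow> 1"
    using assms(1) by (simp add: whp_iff_coins)
  show "\<forall>\<^sub>F n in sequentially. measure_pmf.prob (coins (slots n s) (p n)) {f. Q (kept_hypergraph n s f)}
      \<le> measure_pmf.prob (coins (slots n s) (p n)) {f. R (kept_hypergraph n s f)}"
    by (intro always_eventually allI measure_pmf.finite_measure_mono) (use assms(2) in auto)
qed auto

lemma whp_not_Maker:
  assumes "m \<ge> 1" "b \<ge> 1" "whp s p (has_winning_strategy m b Breaker)"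
  shows "whp s p (\<lambda>H. \<not> has_winning_strategy m b Maker H)"
  by (rule whp_mono[OF assms(3)]) (rule not_Maker_and_Breaker_win; use assms in simp)

section \<open>Counting estimates, growth conditions on the edge probability, and blocks\<close>

lemma binomial_le_power: "n choose k \<le> n ^ k"
  by (cases "k \<le> n") (auto simp: binomial_le_pow binomial_eq_0)

lemma card_slots_superset_le:
  assumes "finite A"
  shows "card {e \<in> slots n s. A \<subseteq> e} \<le> n ^ (s - card A)"
proof -
  have "card {e \<in> slots n s. A \<subseteq> e} \<le> card (slots n (s - card A))"
  proof (rule card_inj_on_le)
    show "inj_on (\<lambda>e. e - A) {e \<in> slots n s. A \<subseteq> e}" by (auto simp: inj_on_def)
    show "(\<lambda>e. e - A) ` {e \<in> slots n s. A \<subseteq> e} \<subseteq> slots n (s - card A)"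
      using assms by (auto simp: card_Diff_subset)
  qed simp
  also have "\<dots> \<le> n ^ (s - card A)" by (simp add: n_subsets binomial_le_power)
  finally show ?thesis .
qed

lemma div_ge_half:
  assumes "K \<ge> 1" "n \<ge> 2 * K"
  shows "real (n div K) \<ge> real n / (2 * real K)"
proof -
  have "n mod K < K" using assms by simp
  then have "n < K * (n div K) + K" using mult_div_mod_eq[of K n] by linarith
  then have "n < 2 * (K * (n div K))" using assms(2) by linarith
  then have "real n < real (2 * (K * (n div K)))" by (simp only: of_nat_less_iff)
  then show ?thesis using assms(1) by (simp add: field_simps)
qed

lemma choose_div_ge:
  assumes "K \<ge> 1" "n \<ge> 2 * K" "n \<ge> K * s"
  shows "real ((n div K) choose s) \<ge> (real n / (2 * real K * real s)) ^ s"
proof -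
  have "s \<le> n div K" using assms by (simp add: less_eq_div_iff_mult_less_eq mult.commute)
  have "real n / (2 * real K * real s) = (real n / (2 * real K)) / real s" by simp
  also have "\<dots> \<le> real (n div K) / real s" using div_ge_half[OF assms(1,2)] by (intro divide_right_mono) auto
  finally have "(real n / (2 * real K * real s)) ^ s \<le> (real (n div K) / real s) ^ s"
    by (intro power_mono) auto
  also have "\<dots> \<le> real ((n div K) choose s)"
    using binomial_ge_n_over_k_pow_k[OF \<open>s \<le> n div K\<close>, where 'a = real] by simp
  finally show ?thesis .
qed

lemma smallomega_powr_at_top:
  fixes p :: "nat \<Rightarrow> real"
  assumes "p \<in> \<omega>(\<lambda>n. real n powr (- a))" "\<And>n. 0 \<le> p n"
  shows "filterlim (\<lambda>n. p n * real n powr a) at_top sequentially"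
  unfolding filterlim_at_top
proof
  fix Z :: real
  have "\<forall>\<^sub>F n in sequentially. norm (p n) \<ge> max Z 1 * norm (real n powr (- a))"
    using assms(1) by (intro landau_omega.smallD) auto
  then show "\<forall>\<^sub>F n in sequentially. Z \<le> p n * real n powr a"
    using eventually_gt_at_top[of 0]
  proof eventually_elim
    case (elim n)
    then have "max Z 1 * real n powr (- a) * real n powr a \<le> p n * real n powr a"
      using assms(2)[of n] by (intro mult_right_mono) auto
    moreover have "real n powr (- a) * real n powr a = 1" using elim by (simp flip: powr_add)
    ultimately show ?case by (simp add: mult.assoc)
  qed
qed

lemma smallo_powr_tendsto_0:
  fixes p :: "nat \<Rightarrow> real"
  assumes "p \<in> o(\<lambda>n. real n powr (- a))"
  shows "(\<lambda>n. p n * real n powr a) \<longlonglongrightarrow> 0"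
  using smalloD_tendsto[OF assms] by (simp add: powr_minus field_simps)

definition block :: "nat \<Rightarrow> nat \<Rightarrow> nat set" where
  "block N t = {t * N..<Suc t * N}"

lemma card_block [simp]: "card (block N t) = N"
  by (simp add: block_def)

lemma finite_block [simp]: "finite (block N t)"
  by (simp add: block_def)

lemma block_subset: "t < K \<Longrightarrow> block (n div K) t \<subseteq> {..<n}"
proof -
  assume "t < K"
  then have "Suc t * (n div K) \<le> K * (n div K)" by (intro mult_le_mono1) simp
  also have "\<dots> \<le> n" by simp
  finally show ?thesis by (auto simp: block_def)
qed

lemma block_disjoint: "t \<noteq> u \<Longrightarrow> block N t \<inter> block N u = {}"
proof (induction t u rule: linorder_wlog)
  case (le t u)
  then have "Suc t * N \<le> u * N" by (intro mult_le_mono1) simp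
  then show ?case by (auto simp: block_def)
qed (auto simp: Int_commute)

section \<open>Case (i): no edges against constantly many disjoint edges\<close>

lemma Breaker_wins_no_edges: "finite V \<Longrightarrow> has_winning_strategy m b Breaker (V, {})"
  by (rule Breaker_wins_private[where g = id and d = 0]) auto

text \<open>First moment: the expected number of edges is at most \<open>p n * n ^ s\<close>, so
  w.h.p. there is no edge at all.\<close>

lemma whp_Breaker_no_edges:
  assumes p: "edge_prob p" "p \<in> o(\<lambda>n. real n powr (- real s))"
  shows "whp s p (has_winning_strategy m b Breaker)"
proof (rule whpI)
  show "(\<lambda>n. p n * real n powr real s) \<longlonglongrightarrow> 0" by (rule smallo_powr_tendsto_0[OF p(2)])
  show "\<forall>\<^sub>F n in sequentially. measure_pmf.prob (coins (slots n s) (p n))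
      {f. \<not> has_winning_strategy m b Breaker (kept_hypergraph n s f)} \<le> p n * real n powr real s"
    using eventually_gt_at_top[of 0]
  proof eventually_elim
    case (elim n)
    have pn: "0 \<le> p n" "p n \<le> 1" using p by (auto simp: edge_prob_def)
    have B: "measure_pmf.prob (coins (slots n s) (p n)) {f. \<exists>e\<in>slots n s. \<forall>e'\<in>{e}. f e'}
        \<le> p n * real n powr real s"
    proof -
      have "measure_pmf.prob (coins (slots n s) (p n)) {f. \<exists>e\<in>slots n s. \<forall>e'\<in>{e}. f e'}
          \<le> (\<Sum>e\<in>slots n s. p n ^ card {e})"
        using pn by (intro prob_some_all_present_le) auto
      also have "\<dots> = real (n choose s) * p n" by (simp add: n_subsets)
      also have "\<dots> \<le> real (n ^ s) * p n"
        using pn binomial_le_power[of n s] by (intro mult_right_mono) (simp_all only: of_nat_le_iff)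
      also have "\<dots> = p n * real n powr real s" using elim by (simp add: powr_realpow)
      finally show ?thesis .
    qed
    show ?case
    proof (rule prob_coins_le[OF _ B])
      fix f assume no: "\<not> has_winning_strategy m b Breaker (kept_hypergraph n s f)"
      have "{e \<in> slots n s. f e} \<noteq> {}"
      proof
        assume none: "{e \<in> slots n s. f e} = {}"
        show False using no Breaker_wins_no_edges[of "{..<n}" m b] unfolding none by simp
      qed
      then show "\<exists>e\<in>slots n s. \<forall>e'\<in>{e}. f e'" by blast
    qed
  qed
qed

text \<open>Each of constantly many blocks holds at least a constant multiple of
  \<open>n ^ s\<close> potential edges, so the probability that a given block contains no edge tends
  to 0, and a union bound covers all blocks.\<close>

lemma whp_Maker_disjoint_edges:
  assumes mb: "s \<le> m \<or> b < m" "m \<ge> 1" "s \<ge> 1" and p: "edge_prob p" "p \<in> \<omega>(\<lambda>n. real n powr (- real s))"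
  shows "whp s p (has_winning_strategy m b Maker)"
proof -
  \<comment> \<open>The number of disjoint edges that \<open>Maker_wins_boxes\<close> asks for, one
    from each block.\<close>
  define K where "K = (m + b) ^ s"
  have K: "K \<ge> 1" using mb by (simp add: K_def)
  define F where "F n i = {e. e \<subseteq> block (n div K) i \<and> card e = s}" for n i
  define c where "c = (1 / (2 * real K * real s)) ^ s"
  have c: "c > 0" using K mb by (simp add: c_def)
  have win: "has_winning_strategy m b Maker (kept_hypergraph n s f)"
    if n: "n \<ge> m" and f: "\<forall>i<K. \<exists>e\<in>F n i. f e" for n f
  proof -
    from f obtain e where e: "\<And>i. i < K \<Longrightarrow> e i \<in> F n i \<and> f (e i)" by metis
    have eE: "e i \<in> {e \<in> slots n s. f e}" if "i < K" for i
      using e[OF that] block_subset[OF that, of n] by (auto simp: F_def)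
    show ?thesis
    proof (cases "s \<le> m")
      case True
      have e0: "e 0 \<subseteq> {..<n}" "card (e 0) = s" "f (e 0)" using eE[of 0] K by auto
      \<comment> \<open>For \<open>s \<le> m\<close> a single edge fits into the first move, padded
        to \<open>m\<close> vertices.\<close>
      obtain C where C: "e 0 \<subseteq> C" "C \<subseteq> {..<n}" "card C = m"
        using exists_subset_between[of "e 0" m "{..<n}"] e0 True n by auto
      show ?thesis
      proof (rule Maker_wins_two_moves[OF _ _ C(2,3)])
        fix Y assume "Y \<subseteq> {..<n} - C"
        then have "e 0 \<inter> Y = {} \<and> e 0 - C = {}" using C(1) by blast
        then have "e 0 \<inter> Y = {} \<and> card (e 0 - C) \<le> m" by (metis card.empty le0)
        then show "\<exists>e\<in>{e \<in> slots n s. f e}. e \<inter> Y = {} \<and> card (e - C) \<le> m"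
          using eE[of 0] K by (intro bexI[of _ "e 0"]) simp_all
      qed auto
    next
      case False
      have dis: "e i \<inter> e j = {}" if "i < K" "j < K" "i \<noteq> j" for i j
        using e[OF that(1)] e[OF that(2)] block_disjoint[OF that(3), of "n div K"] by (auto simp: F_def)
      have ne: "e i \<noteq> {}" if "i < K" for i
      proof
        assume "e i = {}"
        with e[OF that] mb show False by (auto simp: F_def)
      qed
      have "inj_on e {..<K}"
      proof (rule inj_onI, rule ccontr)
        fix i j assume "i \<in> {..<K}" "j \<in> {..<K}" "e i = e j" "i \<noteq> j"
        with dis[of i j] ne[of i] show False by auto
      qed
      then have cD: "card (e ` {..<K}) = K" by (simp add: card_image)
      show ?thesis
      proof (rule Maker_wins_boxes[where D = "e ` {..<K}" and s = s])
        show "disjoint (e ` {..<K})" using dis by (auto simp: disjoint_def)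
        show "(m + b) ^ s \<le> card (e ` {..<K})" using cD K_def by simp
        show "e ` {..<K} \<subseteq> {e \<in> slots n s. f e}" using eE by blast
        show "card x \<le> s" if "x \<in> e ` {..<K}" for x using that eE by auto
      qed (use mb False in auto)
    qed
  qed
  show ?thesis
  proof (rule whpI)
    have "filterlim (\<lambda>n. c * (p n * real n powr real s)) at_top sequentially"
      using c smallomega_powr_at_top[OF p(2)] p(1)
      by (intro filterlim_tendsto_pos_mult_at_top[OF tendsto_const]) (auto simp: edge_prob_def)
    then have "(\<lambda>n. exp (- (c * (p n * real n powr real s)))) \<longlonglongrightarrow> 0"
      by (intro filterlim_compose[OF exp_at_bot]) (simp add: filterlim_uminus_at_bot)
    from tendsto_mult_left[OF this, of "real K"]
    show "(\<lambda>n. real K * exp (- (c * (p n * real n powr real s)))) \<longlonglongrightarrow> 0" by simp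
    show "\<forall>\<^sub>F n in sequentially. measure_pmf.prob (coins (slots n s) (p n))
        {f. \<not> has_winning_strategy m b Maker (kept_hypergraph n s f)}
        \<le> real K * exp (- (c * (p n * real n powr real s)))"
      using eventually_ge_at_top[of "1 + m + 2 * K + K * s"]
    proof eventually_elim
      case (elim n)
      have pn: "0 \<le> p n" "p n \<le> 1" using p by (auto simp: edge_prob_def)
      have choose: "c * real n powr real s \<le> real ((n div K) choose s)"
      proof -
        have "c * real n powr real s = (real n / (2 * real K * real s)) ^ s"
          using elim by (simp add: c_def powr_realpow power_divide)
        also have "\<dots> \<le> real ((n div K) choose s)" using elim K by (intro choose_div_ge) auto
        finally show ?thesis .
      qed
      have one: "measure_pmf.prob (coins (slots n s) (p n)) {f. \<forall>e\<in>F n i. \<not> f e}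
          \<le> exp (- (c * (p n * real n powr real s)))" if "i < K" for i
      proof -
        have "measure_pmf.prob (coins (slots n s) (p n)) {f. \<forall>e\<in>F n i. \<not> f e} = (1 - p n) ^ card (F n i)"
          using block_subset[OF that, of n] pn by (intro prob_all_absent) (auto simp: F_def)
        also have "card (F n i) = (n div K) choose s" by (simp add: F_def n_subsets)
        also have "(1 - p n) ^ \<dots> \<le> exp (- (real ((n div K) choose s) * p n))"
          using pn by (intro one_minus_power_le_exp)
        also have "\<dots> \<le> exp (- (c * (p n * real n powr real s)))"
          using mult_right_mono[OF choose pn(1)] by (simp add: mult_ac)
        finally show ?thesis .
      qed
      have B: "measure_pmf.prob (coins (slots n s) (p n)) {f. \<exists>i<K. \<forall>e\<in>F n i. \<not> f e}
          \<le> real K * exp (- (c * (p n * real n powr real s)))"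
      proof -
        have "{f. \<exists>i<K. \<forall>e\<in>F n i. \<not> f e} = (\<Union>i\<in>{..<K}. {f. \<forall>e\<in>F n i. \<not> f e})" by auto
        then have "measure_pmf.prob (coins (slots n s) (p n)) {f. \<exists>i<K. \<forall>e\<in>F n i. \<not> f e}
            \<le> (\<Sum>i<K. measure_pmf.prob (coins (slots n s) (p n)) {f. \<forall>e\<in>F n i. \<not> f e})"
          using measure_UNION_le[of "{..<K}" "\<lambda>i. {f. \<forall>e\<in>F n i. \<not> f e}" "coins (slots n s) (p n)"] by simp
        also have "\<dots> \<le> (\<Sum>i<K. exp (- (c * (p n * real n powr real s))))"
          using one by (intro sum_mono) auto
        finally show ?thesis by simp
      qed
      show ?case
      proof (rule prob_coins_le[OF _ B])
        fix f assume "\<not> has_winning_strategy m b Maker (kept_hypergraph n s f)"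
        then show "\<exists>i<K. \<forall>e\<in>F n i. \<not> f e" using win[of n f] elim by auto
      qed
    qed
  qed
qed

section \<open>Case (ii): small degrees against stars\<close>

text \<open>First moment over a vertex with \<open>k\<close> edges through it: there are at most
  \<open>n * (n ^ m) ^ k\<close> choices, and the exponent \<open>a\<close> is such that the
  resulting bound is exactly \<open>(p n * n powr a) ^ k\<close>.\<close>

lemma whp_Breaker_small_degree:
  assumes ms: "s = Suc m" and k: "k \<ge> 1" "m * (k - 1) \<le> b"
    and p: "edge_prob p" "p \<in> o(\<lambda>n. real n powr (- (real m + 1 / real k)))"
  shows "whp s p (has_winning_strategy m b Breaker)"
proof (rule whpI)
  define a where "a = real m + 1 / real k"
  have "(\<lambda>n. (p n * real n powr a) ^ k) \<longlonglongrightarrow> 0 ^ k"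
    unfolding a_def by (intro tendsto_power smallo_powr_tendsto_0 p(2))
  then show "(\<lambda>n. (p n * real n powr a) ^ k) \<longlonglongrightarrow> 0" using k by (simp add: power_0_left)
  show "\<forall>\<^sub>F n in sequentially. measure_pmf.prob (coins (slots n s) (p n))
      {f. \<not> has_winning_strategy m b Breaker (kept_hypergraph n s f)} \<le> (p n * real n powr a) ^ k"
    using eventually_gt_at_top[of 0]
  proof eventually_elim
    case (elim n)
    have pn: "0 \<le> p n" "p n \<le> 1" using p by (auto simp: edge_prob_def)
    define D where "D v = {e \<in> slots n s. {v} \<subseteq> e}" for v
    have finD: "finite (D v)" for v 
      by (rule finite_subset[of _ "slots n s"]) (auto simp: D_def)
    define I where "I = Sigma {..<n} (\<lambda>v. {S. S \<subseteq> D v \<and> card S = k})"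
    have finS: "finite {S. S \<subseteq> D v \<and> card S = k}" for v
      by (rule finite_subset[of _ "Pow (D v)"]) (use finD in auto)
    have B: "measure_pmf.prob (coins (slots n s) (p n)) {f. \<exists>i\<in>I. \<forall>e\<in>snd i. f e}
        \<le> (p n * real n powr a) ^ k"
    proof -
      have "measure_pmf.prob (coins (slots n s) (p n)) {f. \<exists>i\<in>I. \<forall>e\<in>snd i. f e}
          \<le> (\<Sum>i\<in>I. p n ^ card (snd i))"
        using pn finS by (intro prob_some_all_present_le) (auto simp: I_def D_def intro!: finite_SigmaI)
      also have "\<dots> = (\<Sum>v<n. \<Sum>S | S \<subseteq> D v \<and> card S = k. p n ^ card S)"
        unfolding I_def using finS by (subst sum.Sigma) (auto simp: case_prod_unfold)
      also have "\<dots> = (\<Sum>v<n. real (card (D v) choose k) * p n ^ k)"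
        using finD by (intro sum.cong) (simp_all add: n_subsets)
      also have "\<dots> \<le> (\<Sum>v<n. (real n ^ m) ^ k * p n ^ k)"
      proof (intro sum_mono mult_right_mono)
        fix v
        have "card (D v) \<le> n ^ m"
          unfolding D_def using card_slots_superset_le[of "{v}" n s] by (simp add: ms)
        then have "card (D v) choose k \<le> (n ^ m) ^ k"
          using binomial_le_power[of "card (D v)" k] power_mono[of "card (D v)" "n ^ m" k] by linarith
        then have "real (card (D v) choose k) \<le> real ((n ^ m) ^ k)" by (simp only: of_nat_le_iff)
        then show "real (card (D v) choose k) \<le> (real n ^ m) ^ k" by simp
      qed (use pn in auto)
      also have "\<dots> = real n * (real n ^ m) ^ k * p n ^ k" by simp
      also have "\<dots> = (p n * real n powr a) ^ k"
      proof -
        have "(real n powr a) ^ k = real n powr (a * real k)"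
          using elim by (simp add: powr_realpow[symmetric] powr_powr)
        also have "a * real k = 1 + real (m * k)" using k by (simp add: a_def field_simps)
        also have "real n powr (1 + real (m * k)) = real n * real n ^ (m * k)"
          using elim unfolding powr_add by (simp add: powr_realpow flip: of_nat_mult)
        finally show ?thesis by (simp add: power_mult_distrib power_mult)
      qed
      finally show ?thesis .
    qed
    show ?case
    proof (rule prob_coins_le[OF _ B], rule ccontr)
      fix f assume no: "\<not> has_winning_strategy m b Breaker (kept_hypergraph n s f)"
        and few: "\<not> (\<exists>i\<in>I. \<forall>e\<in>snd i. f e)"
      let ?E = "{e \<in> slots n s. f e}"
      have "has_winning_strategy m b Breaker (kept_hypergraph n s f)"
      proof (rule Breaker_wins_private[where g = "\<lambda>e. e" and d = "k - 1"])
        fix v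
        show "card {e \<in> ?E. v \<in> e} \<le> k - 1"
        proof (rule ccontr)
          assume "\<not> ?thesis"
          then have "k \<le> card {e \<in> ?E. v \<in> e}" by linarith
          then obtain S where S: "S \<subseteq> {e \<in> ?E. v \<in> e}" "card S = k"
            by (meson obtain_subset_with_card_n)
          then have "S \<noteq> {}" using k by auto
          then have "v < n" using S(1) by blast
          moreover have "S \<subseteq> D v" using S(1) by (auto simp: D_def)
          ultimately have "(v, S) \<in> I" using S(2) by (simp add: I_def)
          with few S(1) show False by force
        qed
      qed (use ms k in auto)
      with no show False by contradiction
    qed
  qed
qed

text \<open>Used for the chance that at least one edge is available for a ray, given the expected
  number \<open>x\<close>: linear while \<open>x\<close> is small, constant afterwards.\<close>

lemma one_minus_exp_neg_ge: "1 - exp (- x) \<ge> min (1 / 2) (x / 2)" if "x \<ge> 0" for x :: real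
proof -
  have "exp (- x) \<le> 1 / (1 + x)"
    using exp_ge_add_one_self[of x] that by (simp add: exp_minus field_simps)
  moreover have "min (1 / 2) (x / 2) \<le> x / (1 + x)"
  proof (cases "x \<le> 1")
    case True
    have "x * (1 + x) \<le> x * 2" using True that by (intro mult_left_mono) auto
    then show ?thesis using that True by (simp add: field_simps min_def)
  next
    case False
    then show ?thesis by (simp add: field_simps min_def)
  qed
  moreover have "1 - 1 / (1 + x) = x / (1 + x)" using that by (simp add: field_simps)
  ultimately show ?thesis by linarith
qed

text \<open>The centre of a star lies in block \<open>W n i 0\<close> and its \<open>j\<close>-th ray in block \<open>W n i j\<close>, so the stars at
  different centres use different potential edges.\<close>

lemma whp_Maker_stars:
  assumes ms: "s = Suc m" "m \<ge> 1" and k: "k \<ge> 1" "m * k > b"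
    and p: "edge_prob p" "p \<in> \<omega>(\<lambda>n. real n powr (- (real m + 1 / real k)))"
  shows "whp s p (has_winning_strategy m b Maker)"
proof -
  define a where "a = real m + 1 / real k"
  \<comment> \<open>Each of the \<open>m\<close> stars owns one block for its centre and
    \<open>k\<close> blocks for its rays.\<close>
  define K where "K = m * Suc k"
  have K: "K \<ge> 1" using ms by (simp add: K_def)
  define W where "W n i j = block (n div K) (i * Suc k + j)" for n i j
  define F where "F n i v j = insert v ` {S. S \<subseteq> W n i j \<and> card S = m}" for n i v j
  define J where "J = {1..k}"
  define N where "N n = (n div K) choose m" for n
  define good where "good n f i v \<longleftrightarrow> (\<forall>j\<in>J. \<exists>e\<in>F n i v j. f e)" for n f i v
  have idx: "i * Suc k + j < K" if "i < m" "j \<le> k" for i j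
  proof -
    have "i * Suc k + j < Suc i * Suc k" using that by simp
    also have "\<dots> \<le> K" unfolding K_def using that by (intro mult_le_mono1) simp
    finally show ?thesis .
  qed
  have idx_inj: "i = i' \<and> j = j'" if "i * Suc k + j = i' * Suc k + j'" "j \<le> k" "j' \<le> k" for i j i' j'
  proof -
    have "(i * Suc k + j) div Suc k = i" "(i' * Suc k + j') div Suc k = i'"
      using that(2,3) by (simp_all add: div_add1_eq del: mult_Suc_right)
    with that(1) have "i = i'" by metis
    with that(1) show ?thesis by simp
  qed
  have Wsub: "W n i j \<subseteq> {..<n}" if "i < m" "j \<le> k" for n i j
    unfolding W_def by (rule block_subset[OF idx[OF that]])
  have Wdis: "W n i j \<inter> W n i' j' = {}" if "(i, j) \<noteq> (i', j')" "j \<le> k" "j' \<le> k" for n i j i' j'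
    unfolding W_def using idx_inj that by (intro block_disjoint) blast
  have vW: "v \<notin> W n i' j" if "v \<in> W n i 0" "j \<in> J" for n i i' v j
    using Wdis[of i 0 i' j n] that by (auto simp: J_def)
  have finW [simp]: "finite (W n i j)" for n i j by (simp add: W_def)
  have Fslot: "F n i v j \<subseteq> slots n s" if "v \<in> W n i 0" "j \<in> J" "i < m" for n i v j
  proof
    fix e assume "e \<in> F n i v j"
    then obtain S where S: "e = insert v S" "S \<subseteq> W n i j" "card S = m" by (auto simp: F_def)
    have "v \<notin> S" using vW[OF that(1,2)] S by blast
    moreover have "finite S" by (rule finite_subset[OF S(2) finW])
    ultimately have "card e = s" using S by (simp add: ms)
    moreover have "W n i 0 \<subseteq> {..<n}" "W n i j \<subseteq> {..<n}"
      using Wsub[OF that(3)] that(2) by (auto simp: J_def)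
    then have "e \<subseteq> {..<n}" using S that(1) by blast
    ultimately show "e \<in> slots n s" by blast
  qed
  have cF: "card (F n i v j) = N n" if "v \<in> W n i 0" "j \<in> J" for n i v j
  proof -
    have "inj_on (insert v) {S. S \<subseteq> W n i j \<and> card S = m}"
      using vW[OF that] by (intro inj_onI) (metis (no_types, lifting) insert_ident mem_Collect_eq subsetD)
    then show ?thesis unfolding F_def by (simp add: card_image n_subsets N_def W_def)
  qed
  have win: "has_winning_strategy m b Maker (kept_hypergraph n s f)"
    if f: "\<forall>i<m. \<exists>v\<in>W n i 0. good n f i v" for n f
  proof -
    from f obtain v where v: "\<And>i. i < m \<Longrightarrow> v i \<in> W n i 0 \<and> good n f i (v i)" by metis
    then have "\<forall>i j. i < m \<and> j \<in> J \<longrightarrow> (\<exists>e\<in>F n i (v i) j. f e)" by (simp add: good_def)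
    then obtain e where e: "\<And>i j. i < m \<Longrightarrow> j \<in> J \<Longrightarrow> e i j \<in> F n i (v i) j \<and> f (e i j)" by metis
    have "inj_on v {..<m}"
    proof (rule inj_onI, rule ccontr)
      fix i j assume "i \<in> {..<m}" "j \<in> {..<m}" "v i = v j" "i \<noteq> j"
      with v[of i] v[of j] Wdis[of i 0 j 0 n] show False by auto
    qed
    then have cC: "card (v ` {..<m}) = m" by (simp add: card_image)
    have CV: "v ` {..<m} \<subseteq> {..<n}" using v Wsub[of _ 0 n] by blast
    show ?thesis
    proof (rule Maker_wins_two_moves[OF _ _ CV cC])
      fix Y assume Y: "Y \<subseteq> {..<n} - v ` {..<m}" "card Y \<le> b"
      have finY: "finite Y" by (rule finite_subset[OF Y(1)]) simp
      \<comment> \<open>Pigeonhole: the \<open>m * k > b\<close> ray blocks are disjoint, so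
        Breaker's first reply misses one of them entirely.\<close>
      have "\<exists>i<m. \<exists>j\<in>J. W n i j \<inter> Y = {}"
      proof (rule ccontr)
        assume "\<not> ?thesis"
        then have "\<forall>x\<in>{..<m} \<times> J. \<exists>y. y \<in> W n (fst x) (snd x) \<inter> Y" by auto
        then obtain y where y: "\<And>x. x \<in> {..<m} \<times> J \<Longrightarrow> y x \<in> W n (fst x) (snd x) \<inter> Y" by metis
        have "inj_on y ({..<m} \<times> J)"
        proof (rule inj_onI, rule ccontr)
          fix x x' assume x: "x \<in> {..<m} \<times> J" "x' \<in> {..<m} \<times> J" "y x = y x'" "x \<noteq> x'"
          with y[OF x(1)] y[OF x(2)] Wdis[of "fst x" "snd x" "fst x'" "snd x'" n] show False
            by (auto simp: J_def)
        qed
        moreover have "y ` ({..<m} \<times> J) \<subseteq> Y" using y by blast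
        ultimately have "card ({..<m} \<times> J) \<le> card Y" using finY by (rule card_inj_on_le)
        then show False using Y(2) k by (simp add: J_def card_cartesian_product)
      qed
      then obtain i j where ij: "i < m" "j \<in> J" "W n i j \<inter> Y = {}" by blast
      obtain S where S: "e i j = insert (v i) S" "S \<subseteq> W n i j" "card S = m"
        using e[OF ij(1,2)] by (auto simp: F_def)
      have "e i j \<inter> Y = {}" using S ij Y(1) by auto
      moreover have "card (e i j - v ` {..<m}) \<le> m"
      proof -
        have "finite S" by (rule finite_subset[OF S(2) finW])
        moreover have "e i j - v ` {..<m} \<subseteq> S" using S(1) ij(1) by auto
        ultimately have "card (e i j - v ` {..<m}) \<le> card S" by (intro card_mono)
        with S(3) show ?thesis by simp
      qed
      moreover have "e i j \<in> {e \<in> slots n s. f e}"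
        using e[OF ij(1,2)] Fslot[of "v i" n i j] v[OF ij(1)] ij by blast
      ultimately show "\<exists>e\<in>{e \<in> slots n s. f e}. e \<inter> Y = {} \<and> card (e - v ` {..<m}) \<le> m" by blast
    qed auto
  qed
  define q where "q n = 1 - (1 - p n) ^ N n" for n
  have pn: "0 \<le> p n" "p n \<le> 1" for n using p by (auto simp: edge_prob_def)
  show ?thesis
  proof (rule whpI)
    define c where "c = (1 / (2 * real K * real m)) ^ m"
    have c: "c > 0" using K ms by (simp add: c_def)
    \<comment> \<open>A lower bound for the expected number of good centres in one block. With
      \<open>x\<close> the expected number of edges for a ray, the first entry is for
      \<open>x > 1\<close>, when a ray exists with probability at least 1/2; the second is for
      \<open>x \<le> 1\<close>, when that probability is at least a constant times
      \<open>n ^ m * p n\<close>.\<close>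
    define L where "L n = min (real n / (2 * real K) * (1 / 2) ^ k) ((c / 2) ^ k / (2 * real K) * (p n * real n powr a) ^ k)" for n
    have "filterlim L at_top sequentially"
    proof -
      have "filterlim (\<lambda>n. (1 / 2) ^ k / (2 * real K) * real n) at_top sequentially"
        using K by (intro filterlim_tendsto_pos_mult_at_top[OF tendsto_const _ filterlim_real_sequentially]) auto
      moreover have "filterlim (\<lambda>n. (c / 2) ^ k / (2 * real K) * (p n * real n powr a) ^ k) at_top sequentially"
        using K c k smallomega_powr_at_top[OF p(2) pn(1)] unfolding a_def
        by (intro filterlim_tendsto_pos_mult_at_top[OF tendsto_const] filterlim_pow_at_top) auto
      ultimately show ?thesis
        unfolding L_def filterlim_at_top by (auto simp: mult.commute eventually_conj_iff)
    qed
    then have "(\<lambda>n. exp (- L n)) \<longlonglongrightarrow> 0"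
      by (intro filterlim_compose[OF exp_at_bot]) (simp add: filterlim_uminus_at_bot)
    from tendsto_mult_left[OF this, of "real m"]
    show "(\<lambda>n. real m * exp (- L n)) \<longlonglongrightarrow> 0" by simp
    show "\<forall>\<^sub>F n in sequentially. measure_pmf.prob (coins (slots n s) (p n))
        {f. \<not> has_winning_strategy m b Maker (kept_hypergraph n s f)} \<le> real m * exp (- L n)"
      using eventually_ge_at_top[of "1 + 2 * K + K * m"]
    proof eventually_elim
      case (elim n)
      have L: "L n \<le> real (n div K) * q n ^ k"
      proof -
        define x where "x = real (N n) * p n"
        have x0: "x \<ge> 0" using pn by (simp add: x_def)
        have "min (1 / 2) (x / 2) \<le> 1 - exp (- x)" by (rule one_minus_exp_neg_ge[OF x0])
        also have "\<dots> \<le> q n" unfolding q_def x_def using one_minus_power_le_exp[OF pn, of n "N n"] by simp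
        finally have q: "min (1 / 2) (x / 2) \<le> q n" .
        have "c * real n ^ m = (real n / (2 * real K * real m)) ^ m"
          by (simp add: c_def power_divide)
        also have "\<dots> \<le> real (N n)" unfolding N_def using elim K by (intro choose_div_ge) auto
        finally have x: "c * real n ^ m * p n \<le> x" unfolding x_def using pn by (intro mult_right_mono)
        have div: "real n / (2 * real K) \<le> real (n div K)" using elim K by (intro div_ge_half) auto
        have "L n \<le> real n / (2 * real K) * (min (1 / 2) (x / 2)) ^ k"
        proof (cases "x \<le> 1")
          case True
          have "L n \<le> (c / 2) ^ k / (2 * real K) * (p n * real n powr a) ^ k" by (simp add: L_def)
          also have "(p n * real n powr a) ^ k = real n * (real n ^ m * p n) ^ k"
          proof -
            have "(real n powr a) ^ k = real n powr (a * real k)"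
              using elim by (simp add: powr_realpow[symmetric] powr_powr)
            also have "a * real k = 1 + real (m * k)" using k by (simp add: a_def field_simps)
            also have "real n powr (1 + real (m * k)) = real n * real n ^ (m * k)"
              using elim unfolding powr_add by (simp add: powr_realpow flip: of_nat_mult)
            finally show ?thesis by (simp add: power_mult_distrib power_mult)
          qed
          also have "(c / 2) ^ k / (2 * real K) * (real n * (real n ^ m * p n) ^ k)
              = real n / (2 * real K) * (c * real n ^ m * p n / 2) ^ k"
            by (simp add: power_mult_distrib power_divide mult_ac)
          also have "\<dots> \<le> real n / (2 * real K) * (x / 2) ^ k"
            using x c pn by (intro mult_left_mono power_mono divide_right_mono) auto
          finally show ?thesis using True by simp
        next
          case False
          then show ?thesis by (simp add: L_def)
        qed
        also have "\<dots> \<le> real (n div K) * q n ^ k"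
          using div q x0 by (intro mult_mono power_mono) auto
        finally show ?thesis .
      qed
      have one: "measure_pmf.prob (coins (slots n s) (p n)) {f. \<forall>v\<in>W n i 0. \<not> good n f i v} \<le> exp (- L n)"
        if i: "i < m" for i
      proof -
        have "measure_pmf.prob (coins (slots n s) (p n)) {f. \<forall>v\<in>W n i 0. \<not> (\<forall>j\<in>J. \<exists>e\<in>F n i v j. f e)}
            \<le> exp (- (real (card (W n i 0)) * (1 - (1 - p n) ^ N n) ^ card J))"
        proof (rule prob_no_star_le)
          show "F n i v j \<subseteq> slots n s \<and> card (F n i v j) = N n" if "v \<in> W n i 0" "j \<in> J" for v j
            using Fslot[OF that i] cF[OF that] by blast
          show "disjoint_family_on (\<lambda>(v, j). F n i v j) (W n i 0 \<times> J)"
            unfolding disjoint_family_on_def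
          proof (clarsimp, rule ccontr)
            fix v j v' j'
            assume v: "v \<in> W n i 0" "v' \<in> W n i 0" and j: "j \<in> J" "j' \<in> J"
              and ne: "v = v' \<longrightarrow> j \<noteq> j'" and "F n i v j \<inter> F n i v' j' \<noteq> {}"
            then obtain S S' where S: "insert v S = insert v' S'" "S \<subseteq> W n i j" "card S = m"
              "S' \<subseteq> W n i j'" "card S' = m" unfolding F_def by blast
            \<comment> \<open>Centres lie outside all ray blocks, so equal edges have equal centres
              and equal remainders.\<close>
            have nv: "v \<notin> S" "v \<notin> S'" "v' \<notin> S" "v' \<notin> S'"
              using vW[OF v(1)] vW[OF v(2)] j S by blast+
            with S(1) have "v = v'" by blast
            with S(1) nv have "S = S'" by (metis insert_ident)
            moreover have "S \<noteq> {}" using S(3) ms by auto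
            ultimately have "W n i j \<inter> W n i j' \<noteq> {}" using S by blast
            with Wdis[of i j i j' n] ne \<open>v = v'\<close> j show False by (auto simp: J_def)
          qed
        qed (use pn in \<open>auto simp: J_def\<close>)
        also have "\<dots> = exp (- (real (n div K) * q n ^ k))" by (simp add: W_def J_def q_def)
        also have "\<dots> \<le> exp (- L n)" using L by simp
        finally show ?thesis by (simp add: good_def)
      qed
      have B: "measure_pmf.prob (coins (slots n s) (p n)) {f. \<exists>i<m. \<forall>v\<in>W n i 0. \<not> good n f i v}
          \<le> real m * exp (- L n)"
      proof -
        have "{f. \<exists>i<m. \<forall>v\<in>W n i 0. \<not> good n f i v} = (\<Union>i\<in>{..<m}. {f. \<forall>v\<in>W n i 0. \<not> good n f i v})"
          by auto
        then have "measure_pmf.prob (coins (slots n s) (p n)) {f. \<exists>i<m. \<forall>v\<in>W n i 0. \<not> good n f i v}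
            \<le> (\<Sum>i<m. measure_pmf.prob (coins (slots n s) (p n)) {f. \<forall>v\<in>W n i 0. \<not> good n f i v})"
          using measure_UNION_le[of "{..<m}" "\<lambda>i. {f. \<forall>v\<in>W n i 0. \<not> good n f i v}" "coins (slots n s) (p n)"]
          by simp
        also have "\<dots> \<le> (\<Sum>i<m. exp (- L n))" using one by (intro sum_mono) auto
        finally show ?thesis by simp
      qed
      show ?case
      proof (rule prob_coins_le[OF _ B])
        fix f assume "\<not> has_winning_strategy m b Maker (kept_hypergraph n s f)"
        then show "\<exists>i<m. \<forall>v\<in>W n i 0. \<not> good n f i v" using win[of n f] by blast
      qed
    qed
  qed
qed

section \<open>Case (iii): Hall's condition against Beck's potential\<close>

text \<open>Stirling-type: \<open>k ^ k / fact k\<close> is a single term of the series for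
  \<open>exp k\<close>. The denominator \<open>k ^ k\<close> is what makes the dense spot estimate
  uniform in their size.\<close>

lemma binomial_le_exp: "real (N choose k) \<le> real N ^ k * exp (real k) / real k ^ k"
proof (cases "k = 0")
  case False
  have "real k ^ k / fact k \<le> exp (real k)"
  proof -
    have "(\<Sum>i\<in>{k}. inverse (fact i) *\<^sub>R real k ^ i) \<le> (\<Sum>i. inverse (fact i) *\<^sub>R real k ^ i)"
      by (rule sum_le_suminf[OF summable_exp_generic]) auto
    then show ?thesis by (simp add: exp_def divide_inverse mult.commute)
  qed
  then have k: "real k ^ k \<le> exp (real k) * fact k" by (simp add: field_simps)
  have "real ((N choose k) * fact k) \<le> real (N ^ k)" using binomial_fact_pow by (simp only: of_nat_le_iff)
  then have N: "real (N choose k) * fact k \<le> real N ^ k" by simp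
  have "real (N choose k) * real k ^ k \<le> real (N choose k) * (exp (real k) * fact k)"
    using k by (intro mult_left_mono) auto
  also have "\<dots> = real (N choose k) * fact k * exp (real k)" by simp
  also have "\<dots> \<le> real N ^ k * exp (real k)" using N by (intro mult_right_mono) auto
  finally show ?thesis using False by (simp add: field_simps)
qed simp

text \<open>An obstruction to Hall's condition with \<open>d = s - 1\<close> spans some \<open>t\<close> vertices and contains
  \<open>f = t div d + 1\<close> edges on them; \<open>d * f > t\<close> leaves a spare factor \<open>t / n\<close>.\<close>

lemma dense_spot_expectation_le:
  fixes p :: real
  assumes d: "d \<ge> 1" and t: "1 \<le> t" "t \<le> n" and f: "f = Suc (t div d)"
    and p: "0 \<le> p" "p \<le> 1 / (exp (real (Suc d)) * real d * 4 ^ d) / real n ^ d"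
  shows "real (n choose t) * real ((t choose Suc d) choose f) * p ^ f \<le> (1 / 2) ^ t / real n"
proof -
  define c where "c = 1 / (exp (real (Suc d)) * real d * 4 ^ d)"
  have c: "c > 0" using d by (simp add: c_def)
  have n: "real n > 0" using t by simp
  have tf: "t < d * f"
  proof -
    have "t mod d < d" using d by simp
    moreover have "d * (t div d) + t mod d = t" by simp
    ultimately show ?thesis unfolding f mult_Suc_right by linarith
  qed
  \<comment> \<open>The powers of \<open>n\<close> gained by choosing \<open>t\<close> vertices fall
    short of those lost in \<open>p ^ f\<close> by \<open>r \<ge> 1\<close>, which leaves the factor
    \<open>(t / n) ^ r\<close>.\<close>
  define r where "r = d * f - t"
  have r: "d * f = t + r" "r \<ge> 1" using tf by (auto simp: r_def)
  have fpos: "f \<ge> 1" by (simp add: f)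
  have A: "real (n choose t) \<le> real n ^ t * exp (real t) / real t ^ t" by (rule binomial_le_exp)
  have B: "real ((t choose Suc d) choose f) \<le> (real t ^ Suc d) ^ f * exp (real f) / real f ^ f"
  proof -
    have "real ((t choose Suc d) choose f) \<le> real (t choose Suc d) ^ f * exp (real f) / real f ^ f"
      by (rule binomial_le_exp)
    also have "\<dots> \<le> (real t ^ Suc d) ^ f * exp (real f) / real f ^ f"
    proof (intro divide_right_mono mult_right_mono power_mono)
      have "real (t choose Suc d) \<le> real (t ^ Suc d)" using binomial_le_power by (simp only: of_nat_le_iff)
      then show "real (t choose Suc d) \<le> real t ^ Suc d" by simp
    qed auto
    finally show ?thesis .
  qed
  have C: "p ^ f \<le> (c / real n ^ d) ^ f" using p by (intro power_mono) (auto simp: c_def)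
  have "real (n choose t) * real ((t choose Suc d) choose f) * p ^ f
      \<le> (real n ^ t * exp (real t) / real t ^ t) * ((real t ^ Suc d) ^ f * exp (real f) / real f ^ f)
        * (c / real n ^ d) ^ f"
    using p by (intro mult_mono A B C) auto
  also have "\<dots> = exp (real t + real f) * (real t / real f) ^ f * (real t / real n) ^ r * c ^ f"
  proof -
    have 1: "(real t ^ Suc d) ^ f = real t ^ t * real t ^ r * real t ^ f"
    proof -
      have "(real t ^ Suc d) ^ f = real t ^ (Suc d * f)" by (rule power_mult[symmetric])
      also have "Suc d * f = t + r + f" using r by simp
      finally show ?thesis by (simp only: power_add)
    qed
    have 2: "(real n ^ d) ^ f = real n ^ t * real n ^ r"
      by (simp add: power_mult[symmetric] r power_add)
    show ?thesis
      unfolding 1 power_divide 2 exp_add using n t fpos by (simp add: field_simps)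
  qed
  also have "\<dots> \<le> exp (real (Suc d)) ^ f * real d ^ f * (real t / real n) * c ^ f"
  proof (intro mult_mono)
    have "t + f \<le> Suc d * f" using tf by simp
    then have "real t + real f \<le> real (Suc d) * real f" by (simp only: of_nat_add[symmetric] of_nat_mult[symmetric] of_nat_le_iff)
    then have "exp (real t + real f) \<le> exp (real f * real (Suc d))" by (simp add: mult.commute)
    then show "exp (real t + real f) \<le> exp (real (Suc d)) ^ f" by (simp only: exp_of_nat_mult)
    have "real t \<le> real d * real f" using tf by (simp only: of_nat_mult[symmetric] of_nat_le_iff)
    then show "(real t / real f) ^ f \<le> real d ^ f"
      using fpos by (intro power_mono) (simp_all add: divide_le_eq)
    have "(real t / real n) ^ r \<le> (real t / real n) ^ 1" using r t by (intro power_decreasing) auto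
    then show "(real t / real n) ^ r \<le> real t / real n" by simp
  qed (use c in auto)
  also have "\<dots> = (exp (real (Suc d)) * real d * c) ^ f * (real t / real n)"
    by (simp add: power_mult_distrib)
  \<comment> \<open>The constant \<open>c\<close> is chosen for this line: the remaining factors
    amount to \<open>1 / 4 ^ d\<close> per edge, hence to at most \<open>1 / 4 ^ t\<close> in all
    since \<open>d * f > t\<close>. Giving up a factor \<open>2 ^ t\<close> absorbs
    \<open>t\<close>, and the rest is summable.\<close>
  also have "exp (real (Suc d)) * real d * c = 1 / 4 ^ d" using d by (simp add: c_def)
  also have "(1 / 4 ^ d) ^ f = (1 / 4 :: real) ^ (d * f)" by (simp add: power_mult power_one_over)
  also have "\<dots> * (real t / real n) \<le> (1 / 4) ^ t * (real t / real n)"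
    using tf by (intro mult_right_mono power_decreasing) auto
  also have "\<dots> \<le> (1 / 4) ^ t * (2 ^ t / real n)"
  proof (intro mult_left_mono divide_right_mono)
    have "real t < real (2 ^ t)" using less_exp[of t] by (simp only: of_nat_less_iff)
    then show "real t \<le> 2 ^ t" by simp
  qed auto
  also have "\<dots> = (1 / 2) ^ t / real n" by (simp flip: power_mult_distrib)
  finally show ?thesis .
qed

text \<open>If Hall's condition fails at \<open>F\<close>, then \<open>\<Union>F\<close> with
  suitably many edges of \<open>F\<close> is a dense spot, and a union bound over all sizes makes
  this unlikely. Otherwise the parts are disjoint, so one Maker turn meets at most
  \<open>m \<le> b\<close> of them.\<close>

lemma whp_Breaker_sparse:
  assumes d: "d \<ge> 1" "m < d" "m \<le> b" and p: "edge_prob p"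
    and le: "\<forall>\<^sub>F n in sequentially. p n \<le> 1 / (exp (real (Suc d)) * real d * 4 ^ d) / real n ^ d"
  shows "whp (Suc d) p (has_winning_strategy m b Breaker)"
proof (rule whpI)
  show "(\<lambda>n. 1 / real n) \<longlonglongrightarrow> 0" by (rule lim_1_over_n)
  show "\<forall>\<^sub>F n in sequentially. measure_pmf.prob (coins (slots n (Suc d)) (p n))
      {f. \<not> has_winning_strategy m b Breaker (kept_hypergraph n (Suc d) f)} \<le> 1 / real n"
    using le eventually_gt_at_top[of 0]
  proof eventually_elim
    case (elim n)
    have pn: "0 \<le> p n" "p n \<le> 1" using p by (auto simp: edge_prob_def)
    \<comment> \<open>The least \<open>f\<close> with \<open>d * f > t\<close>; a violating family
      is trimmed to exactly this many edges, so only one family size per \<open>t\<close> has to be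
      counted.\<close>
    define G where "G t = Suc (t div d)" for t
    define spans where "spans T = {F. F \<subseteq> {e. e \<subseteq> T \<and> card e = Suc d} \<and> card F = G (card T)}" for T :: "nat set"
    have finT: "finite T" if "T \<subseteq> {..<n}" for T using that by (rule finite_subset) simp
    have fin1: "finite {e. e \<subseteq> T \<and> card e = Suc d}" if "T \<subseteq> {..<n}" for T
      by (rule finite_subset[of _ "Pow T"]) (use finT[OF that] in auto)
    have fin2: "finite (spans T)" if "T \<subseteq> {..<n}" for T
      unfolding spans_def by (rule finite_subset[of _ "Pow {e. e \<subseteq> T \<and> card e = Suc d}"]) (use fin1[OF that] in auto)
    define I where "I = (SIGMA t:{1..n}. SIGMA T:{T. T \<subseteq> {..<n} \<and> card T = t}. spans T)"
    have finI2: "finite (SIGMA T:{T. T \<subseteq> {..<n} \<and> card T = t}. spans T)" for t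
      using fin2 by (intro finite_SigmaI) auto
    have B: "measure_pmf.prob (coins (slots n (Suc d)) (p n)) {f. \<exists>i\<in>I. \<forall>e\<in>snd (snd i). f e} \<le> 1 / real n"
    proof -
      have "measure_pmf.prob (coins (slots n (Suc d)) (p n)) {f. \<exists>i\<in>I. \<forall>e\<in>snd (snd i). f e}
          \<le> (\<Sum>i\<in>I. p n ^ card (snd (snd i)))"
      proof (rule prob_some_all_present_le)
        show "finite I" unfolding I_def by (rule finite_SigmaI[OF _ finI2]) simp
        show "snd (snd i) \<subseteq> slots n (Suc d)" if "i \<in> I" for i
        proof -
          from that obtain T where "T \<subseteq> {..<n}" "snd (snd i) \<subseteq> {e. e \<subseteq> T \<and> card e = Suc d}"
            by (auto simp: I_def spans_def)
          then show ?thesis by blast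
        qed
      qed (use pn in auto)
      also have "\<dots> = (\<Sum>t\<in>{1..n}. \<Sum>i\<in>(SIGMA T:{T. T \<subseteq> {..<n} \<and> card T = t}. spans T). p n ^ card (snd i))"
        unfolding I_def using finI2 by (subst sum.Sigma) (auto simp: case_prod_unfold)
      also have "\<dots> = (\<Sum>t\<in>{1..n}. \<Sum>T | T \<subseteq> {..<n} \<and> card T = t. \<Sum>F\<in>spans T. p n ^ card F)"
        using fin2 by (intro sum.cong refl, subst sum.Sigma) (auto simp: case_prod_unfold)
      also have "\<dots> = (\<Sum>t\<in>{1..n}. real (n choose t) * (real ((t choose Suc d) choose G t) * p n ^ G t))"
      proof (rule sum.cong[OF refl])
        fix t
        have "(\<Sum>T | T \<subseteq> {..<n} \<and> card T = t. \<Sum>F\<in>spans T. p n ^ card F)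
            = (\<Sum>T | T \<subseteq> {..<n} \<and> card T = t. real ((t choose Suc d) choose G t) * p n ^ G t)"
        proof (rule sum.cong[OF refl])
          fix T assume "T \<in> {T. T \<subseteq> {..<n} \<and> card T = t}"
          then have T: "T \<subseteq> {..<n}" "card T = t" by auto
          have "(\<Sum>F\<in>spans T. p n ^ card F) = (\<Sum>F\<in>spans T. p n ^ G t)"
            using T by (intro sum.cong) (auto simp: spans_def)
          also have "\<dots> = real (card (spans T)) * p n ^ G t" by simp
          also have "card (spans T) = (t choose Suc d) choose G t"
            unfolding spans_def using T fin1[OF T(1)] finT[OF T(1)] by (simp add: n_subsets)
          finally show "(\<Sum>F\<in>spans T. p n ^ card F) = real ((t choose Suc d) choose G t) * p n ^ G t" .
        qed
        also have "\<dots> = real (n choose t) * (real ((t choose Suc d) choose G t) * p n ^ G t)"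
          by (simp add: n_subsets)
        finally show "(\<Sum>T | T \<subseteq> {..<n} \<and> card T = t. \<Sum>F\<in>spans T. p n ^ card F)
          = real (n choose t) * (real ((t choose Suc d) choose G t) * p n ^ G t)" .
      qed
      also have "\<dots> \<le> (\<Sum>t\<in>{1..n}. (1 / 2) ^ t / real n)"
      proof (rule sum_mono)
        fix t assume "t \<in> {1..n}"
        then show "real (n choose t) * (real ((t choose Suc d) choose G t) * p n ^ G t) \<le> (1 / 2) ^ t / real n"
          using dense_spot_expectation_le[of d t n "G t" "p n"] d pn elim(1) by (simp add: G_def mult.assoc)
      qed
      also have "\<dots> = (\<Sum>t\<in>{1..n}. (1 / 2) ^ t) / real n" by (simp add: sum_divide_distrib)
      also have "(\<Sum>t\<in>{1..n}. (1 / 2 :: real) ^ t) = 1 - (1 / 2) ^ n"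
        by (induction n) (simp_all add: field_simps)
      also have "(1 - (1 / 2 :: real) ^ n) / real n \<le> 1 / real n" by (intro divide_right_mono) auto
      finally show ?thesis .
    qed
    show ?case
    proof (rule prob_coins_le[OF _ B], rule ccontr)
      fix f assume no: "\<not> has_winning_strategy m b Breaker (kept_hypergraph n (Suc d) f)"
        and sparse: "\<not> (\<exists>i\<in>I. \<forall>e\<in>snd (snd i). f e)"
      let ?E = "{e \<in> slots n (Suc d). f e}"
      have finE: "finite ?E" by (rule finite_subset[OF _ finite_slots[of n "Suc d"]]) auto
      have hall: "d * card F \<le> card (\<Union>F)" if F: "F \<subseteq> ?E" for F
      proof (rule ccontr)
        assume dense: "\<not> ?thesis"
        define T where "T = \<Union>F"
        define t where "t = card T"
        have T: "T \<subseteq> {..<n}" using F by (auto simp: T_def)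
        have "F \<noteq> {}" using dense by auto
        then obtain e where e: "e \<in> F" by blast
        then have "card e = Suc d" "e \<subseteq> T" using F by (auto simp: T_def)
        then have "t \<ge> 1" using card_mono[OF finT[OF T], of e] by (simp add: t_def)
        moreover have "t \<le> n" using card_mono[OF _ T] by (simp add: t_def)
        moreover have "G t \<le> card F"
        proof -
          have "t < d * card F" using dense by (simp add: t_def T_def)
          then have "t div d < card F" using d by (simp add: less_mult_imp_div_less mult.commute)
          then show ?thesis by (simp add: G_def)
        qed
        then obtain F' where F': "F' \<subseteq> F" "card F' = G t" by (meson obtain_subset_with_card_n)
        have "F' \<subseteq> {e. e \<subseteq> T \<and> card e = Suc d}" using F F' by (auto simp: T_def)
        then have "F' \<in> spans T" using F' by (simp add: spans_def t_def)
        ultimately have "(t, T, F') \<in> I" using T by (simp add: I_def t_def)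
        moreover have "\<forall>e\<in>F'. f e" using F F' by blast
        ultimately show False using sparse by force
      qed
      have fe: "finite e" if "e \<in> ?E" for e using that by (auto intro: finT)
      have "\<exists>g. (\<forall>e\<in>?E. g e \<subseteq> e \<and> card (g e) = d) \<and>
          (\<forall>e\<in>?E. \<forall>f\<in>?E. e \<noteq> f \<longrightarrow> g e \<inter> g f = {})"
        by (rule hall_disjoint_subsets[OF finE fe hall])
      then obtain g where gd: "(\<forall>e\<in>?E. g e \<subseteq> e \<and> card (g e) = d) \<and>
          (\<forall>e\<in>?E. \<forall>f\<in>?E. e \<noteq> f \<longrightarrow> g e \<inter> g f = {})" ..
      note g = conjunct1[OF gd] and dis = conjunct2[OF gd]
      have "has_winning_strategy m b Breaker (kept_hypergraph n (Suc d) f)"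
      proof (rule Breaker_wins_private[where g = g and d = 1])
        fix v
        have "finite {e \<in> ?E. v \<in> g e}" using finE by (rule finite_subset[rotated]) auto
        moreover have "\<forall>e\<in>{e \<in> ?E. v \<in> g e}. \<forall>e'\<in>{e \<in> ?E. v \<in> g e}. e = e'"
          using dis by blast
        ultimately show "card {e \<in> ?E. v \<in> g e} \<le> 1"
          unfolding One_nat_def by (simp only: card_le_Suc0_iff_eq)
      next
        show "g e \<subseteq> e \<and> m < card (g e)" if "e \<in> ?E" for e using g that d by auto
      qed (use d in auto)
      with no show False by contradiction
    qed
  qed
qed

text \<open>Lets Maker play on a thinned hypergraph: legality of moves depends on the vertices only,
  so the same strategy remains valid when edges are added.\<close>

lemma Maker_wins_more_edges:
  assumes "has_winning_strategy m b Maker (V, E')" "E' \<subseteq> E"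
  shows "has_winning_strategy m b Maker (V, E)"
proof -
  obtain \<sigma> where \<sigma>: "strategy m b V Maker \<sigma>"
    and win: "\<And>h. legal_history m b V h \<Longrightarrow> unpicked V h = {} \<Longrightarrow> follows Maker \<sigma> h \<Longrightarrow> winner (V, E') h = Maker"
    using assms(1) by (auto simp: has_winning_strategy_def)
  have "winner (V, E) h = Maker" if "winner (V, E') h = Maker" for h
  proof -
    have "\<exists>e\<in>E'. e \<subseteq> picked_by Maker h" using that by (auto simp: winner_def split: if_splits)
    then show ?thesis using assms(2) by (auto simp: winner_def)
  qed
  with \<sigma> win show ?thesis unfolding has_winning_strategy_def by fastforce
qed

text \<open>Beck's criterion asks for more than \<open>L * n\<close> edges and pair degrees at most
  2. Both are likely at density \<open>q = c / n ^ (s - 1)\<close>; since large pair degrees appear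
  for larger \<open>p\<close>, Maker plays on a thinned copy.\<close>

lemma whp_Maker_dense:
  assumes s: "s \<ge> 2" and m: "m \<ge> 1" and p: "edge_prob p"
    and ge: "\<forall>\<^sub>F n in sequentially.
      p n \<ge> 2 * real s ^ s * (real (b * (b * 2 * (b + 1) ^ s)) + 1) / real n ^ (s - 1)"
  shows "whp s p (has_winning_strategy m b Maker)"
proof -
  define L where "L = b * (b * 2 * (b + 1) ^ s)"
  \<comment> \<open>At density \<open>c / n ^ (s - 1)\<close> at least \<open>n ^ s / s ^ s\<close>
    potential edges give expectation at least \<open>2 * n * (L + 1)\<close>. The 2 offsets the one
    in \<open>prob_few_present_le\<close>, and the exponent \<open>- n * (L + 1)\<close> then beats
    the factor \<open>2 ^ (L * n)\<close>.\<close>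
  define c where "c = 2 * real s ^ s * (real L + 1)"
  have c: "c > 0" using s by (simp add: c_def)
  define few where "few n f \<longleftrightarrow> card {e \<in> slots n s. f e} \<le> L * n" for n and f :: "nat set \<Rightarrow> bool"
  define through where "through n x y = {e \<in> slots n s. {x, y} \<subseteq> e}" for n and x y :: nat
  \<comment> \<open>Three edges through a pair have expected number at most
    \<open>n ^ 2 * (n ^ (s - 2) * q) ^ 3\<close>, which is \<open>c ^ 3 / n\<close>; the same count
    for two edges would stay constant.\<close>
  define I where "I n = Sigma ({..<n} \<times> {..<n} - Id) (\<lambda>(x, y). {S. S \<subseteq> through n x y \<and> card S = 3})" for n
  define crowded where "crowded n f \<longleftrightarrow> (\<exists>i\<in>I n. \<forall>e\<in>snd i. f e)" for n and f :: "nat set \<Rightarrow> bool"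
  have fint: "finite (through n x y)" for n x y
    by (rule finite_subset[of _ "slots n s"]) (auto simp: through_def)
  have finS: "finite {S. S \<subseteq> through n x y \<and> card S = 3}" for n x y
    by (rule finite_subset[of _ "Pow (through n x y)"]) (use fint in auto)
  have win: "has_winning_strategy m b Maker (kept_hypergraph n s f)"
    if f: "\<And>x. g x \<Longrightarrow> f x" and g: "\<not> few n g" "\<not> crowded n g" for n f g
  proof (rule Maker_wins_more_edges)
    let ?E = "{e \<in> slots n s. g e}"
    show "has_winning_strategy m b Maker (kept_hypergraph n s g)"
    proof (rule Maker_wins_potential[where s = s and \<Delta> = 2])
      show "b * (b * 2 * (b + 1) ^ s) * card {..<n} < card ?E"
        using g(1) unfolding few_def L_def[symmetric] by simp
      fix x y :: nat assume xy: "x \<noteq> y"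
      show "card {e \<in> ?E. x \<in> e \<and> y \<in> e} \<le> 2"
      proof (rule ccontr)
        assume "\<not> ?thesis"
        then have "3 \<le> card {e \<in> ?E. x \<in> e \<and> y \<in> e}" by linarith
        then obtain S where S: "S \<subseteq> {e \<in> ?E. x \<in> e \<and> y \<in> e}" "card S = 3"
          by (meson obtain_subset_with_card_n)
        then have "S \<noteq> {}" by auto
        then have "x < n" "y < n" using S(1) by blast+
        moreover have "S \<subseteq> through n x y" using S(1) by (auto simp: through_def)
        ultimately have "((x, y), S) \<in> I n" using S(2) xy by (simp add: I_def)
        moreover have "\<forall>e\<in>S. g e" using S(1) by blast
        ultimately have "crowded n g" unfolding crowded_def by force
        with g(2) show False by contradiction
      qed
    qed (use m in auto)
    show "?E \<subseteq> {e \<in> slots n s. f e}" using f by blast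
  qed
  show ?thesis
  proof (rule whpI)
    have "(\<lambda>n. exp (- real n)) \<longlonglongrightarrow> 0"
      by (intro filterlim_compose[OF exp_at_bot]) (simp add: filterlim_uminus_at_bot filterlim_real_sequentially)
    moreover have "(\<lambda>n. c ^ 3 * (1 / real n)) \<longlonglongrightarrow> c ^ 3 * 0" by (intro tendsto_mult_left lim_1_over_n)
    ultimately show "(\<lambda>n. exp (- real n) + c ^ 3 * (1 / real n)) \<longlonglongrightarrow> 0"
      using tendsto_add by fastforce
    show "\<forall>\<^sub>F n in sequentially. measure_pmf.prob (coins (slots n s) (p n))
        {f. \<not> has_winning_strategy m b Maker (kept_hypergraph n s f)} \<le> exp (- real n) + c ^ 3 * (1 / real n)"
      using ge eventually_ge_at_top[of s] eventually_gt_at_top[of 0]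
    proof eventually_elim
      case (elim n)
      have pn: "0 \<le> p n" "p n \<le> 1" using p by (auto simp: edge_prob_def)
      define q where "q = c / real n ^ (s - 1)"
      have q: "0 \<le> q" "q \<le> p n" "q \<le> 1"
        using elim(1) pn c unfolding q_def c_def L_def[symmetric] by auto
      let ?P = "measure_pmf.prob (coins (slots n s) q)"
      have B1: "?P {f. few n f} \<le> exp (- real n)"
      proof -
        have "?P {f. few n f} \<le> 2 ^ (L * n) * exp (- (real (card (slots n s)) * q / 2))"
          unfolding few_def by (rule prob_few_present_le) (use q in auto)
        also have "\<dots> \<le> exp (real L * real n) * exp (- (real n * (real L + 1)))"
        proof (intro mult_mono)
          have "(2 :: real) ^ (L * n) \<le> exp 1 ^ (L * n)"
            using exp_ge_add_one_self[of 1] by (intro power_mono) auto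
          also have "\<dots> = exp (real L * real n)" by (simp flip: exp_of_nat_mult)
          finally show "(2 :: real) ^ (L * n) \<le> exp (real L * real n)" .
          have "real n ^ s / real s ^ s \<le> real (card (slots n s))"
            using binomial_ge_n_over_k_pow_k[OF elim(2), where 'a = real]
            by (simp add: n_subsets power_divide)
          then have "real n ^ s / real s ^ s * q \<le> real (card (slots n s)) * q"
            using q by (intro mult_right_mono)
          moreover have "real n ^ s / real s ^ s * q = 2 * (real n * (real L + 1))"
          proof -
            have "real n ^ s = real n * real n ^ (s - 1)" using s by (cases s) auto
            then show ?thesis unfolding q_def c_def using elim(3) s by simp
          qed
          ultimately show "exp (- (real (card (slots n s)) * q / 2)) \<le> exp (- (real n * (real L + 1)))"
            by simp
        qed auto
        also have "\<dots> = exp (- real n)" by (simp add: algebra_simps flip: exp_add)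
        finally show ?thesis .
      qed
      have B2: "?P {f. crowded n f} \<le> c ^ 3 * (1 / real n)"
      proof -
        have finI: "finite (I n)" unfolding I_def using finS by (intro finite_SigmaI) auto
        have "?P {f. crowded n f} \<le> (\<Sum>i\<in>I n. q ^ card (snd i))"
          unfolding crowded_def
        proof (rule prob_some_all_present_le)
          show "snd i \<subseteq> slots n s" if "i \<in> I n" for i
            using that by (auto simp: I_def through_def)
        qed (use finI q in auto)
        also have "\<dots> = (\<Sum>i\<in>I n. q ^ 3)" by (rule sum.cong) (auto simp: I_def)
        also have "\<dots> = real (card (I n)) * q ^ 3" by simp
        also have "\<dots> \<le> (real n ^ 2 * (real n ^ (s - 2)) ^ 3) * q ^ 3"
        proof (intro mult_right_mono)
          have "card (I n) = (\<Sum>z\<in>{..<n} \<times> {..<n} - Id. card {S. S \<subseteq> through n (fst z) (snd z) \<and> card S = 3})"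
            unfolding I_def using finS by (subst card_SigmaI) (auto simp: case_prod_unfold)
          also have "\<dots> \<le> (\<Sum>z\<in>{..<n} \<times> {..<n} - Id. (n ^ (s - 2)) ^ 3)"
          proof (rule sum_mono)
            fix z assume z: "z \<in> {..<n} \<times> {..<n} - Id"
            have "card (through n (fst z) (snd z)) \<le> n ^ (s - 2)"
              unfolding through_def using card_slots_superset_le[of "{fst z, snd z}" n s] z
              by (cases z) (auto simp: numeral_2_eq_2)
            then have "card (through n (fst z) (snd z)) ^ 3 \<le> (n ^ (s - 2)) ^ 3" by (rule power_mono) simp
            moreover have "card {S. S \<subseteq> through n (fst z) (snd z) \<and> card S = 3}
                \<le> card (through n (fst z) (snd z)) ^ 3"
              unfolding n_subsets[OF fint] by (rule binomial_le_power)
            ultimately show "card {S. S \<subseteq> through n (fst z) (snd z) \<and> card S = 3} \<le> (n ^ (s - 2)) ^ 3"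
              by (rule le_trans[rotated])
          qed
          also have "\<dots> = card ({..<n} \<times> {..<n} - Id) * (n ^ (s - 2)) ^ 3" by simp
          also have "\<dots> \<le> n ^ 2 * (n ^ (s - 2)) ^ 3"
          proof (rule mult_le_mono1)
            have "card ({..<n} \<times> {..<n} - Id) \<le> card ({..<n} \<times> {..<n})" by (intro card_mono) auto
            then show "card ({..<n} \<times> {..<n} - Id) \<le> n ^ 2" by (simp add: card_cartesian_product power2_eq_square)
          qed
          finally have "real (card (I n)) \<le> real (n ^ 2 * (n ^ (s - 2)) ^ 3)" by (simp only: of_nat_le_iff)
          then show "real (card (I n)) \<le> real n ^ 2 * (real n ^ (s - 2)) ^ 3" by simp
        qed (use q in auto)
        also have "\<dots> = c ^ 3 * (1 / real n)"
        proof -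
          have "s - 1 = Suc (s - 2)" using s by simp
          then have "q ^ 3 = c ^ 3 / (real n ^ 3 * (real n ^ (s - 2)) ^ 3)"
            unfolding q_def by (simp add: power_divide power_mult_distrib)
          then show ?thesis using elim(3) by (simp add: power2_eq_square power3_eq_cube)
        qed
        finally show ?thesis .
      qed
      \<comment> \<open>\<open>\<not> few\<close> is increasing but \<open>\<not> crowded\<close> is
        decreasing, so monotonicity in the density does not apply to their conjunction. Asking for a
        good subset \<open>g\<close> of the kept edges makes the property increasing.\<close>
      define Q where "Q f \<longleftrightarrow> (\<exists>g. (\<forall>x. g x \<longrightarrow> f x) \<and> \<not> few n g \<and> \<not> crowded n g)" for f
      have compl: "measure_pmf.prob M {f. \<not> Q f} = 1 - measure_pmf.prob M {f. Q f}" for M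
      proof -
        have "{f. \<not> Q f} = UNIV - {f. Q f}" by auto
        then show ?thesis using measure_pmf.prob_compl[of "{f. Q f}" M] by simp
      qed
      have "?P {f. \<not> Q f} \<le> ?P ({f. few n f} \<union> {f. crowded n f})"
      proof (rule measure_pmf.finite_measure_mono)
        show "{f. \<not> Q f} \<subseteq> {f. few n f} \<union> {f. crowded n f}" unfolding Q_def by auto
      qed simp
      also have "\<dots> \<le> ?P {f. few n f} + ?P {f. crowded n f}"
        by (rule measure_Un_le) auto
      finally have "?P {f. \<not> Q f} \<le> exp (- real n) + c ^ 3 * (1 / real n)" using B1 B2 by linarith
      moreover have "?P {f. Q f} \<le> measure_pmf.prob (coins (slots n s) (p n)) {f. Q f}"
      proof (rule prob_coins_mono)
        show "Q g" if "\<And>x. f x \<Longrightarrow> g x" "Q f" for f g using that unfolding Q_def by meson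
      qed (use q pn in simp_all)
      ultimately have B: "measure_pmf.prob (coins (slots n s) (p n)) {f. \<not> Q f}
          \<le> exp (- real n) + c ^ 3 * (1 / real n)"
        unfolding compl by linarith
      show ?case
      proof (rule prob_coins_le[OF _ B])
        fix f assume "\<not> has_winning_strategy m b Maker (kept_hypergraph n s f)"
        then show "\<not> Q f" unfolding Q_def using win[of _ f n] by blast
      qed
    qed
  qed
qed

section \<open>The exponent in (ii) and the assembly of the three cases\<close>

text \<open>Identifies \<open>k\<close> as the least integer with \<open>m * k > b\<close>. One
  inequality is what Maker's stars need, the other what Breaker's degree bound needs, so both sides
  share one exponent.\<close>

lemma ceiling_division:
  fixes b m :: nat
  assumes "m \<ge> 1"
  defines "k \<equiv> nat \<lceil>(real b + 1) / real m\<rceil>"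
  shows "k \<ge> 1" "m * (k - 1) \<le> b" "m * k > b"
    "real_of_int \<lceil>(real b + 1) / real m\<rceil> = real k"
proof -
  define x where "x = (real b + 1) / real m"
  have x: "x > 0" using assms(1) by (simp add: x_def)
  then have "\<lceil>x\<rceil> \<ge> 1" by linarith
  then show k: "k \<ge> 1" "real_of_int \<lceil>(real b + 1) / real m\<rceil> = real k"
    unfolding k_def x_def[symmetric] by linarith+
  have mx: "real m * x = real b + 1" using assms(1) by (simp add: x_def)
  have ge: "x \<le> real k" and lt: "real (k - 1) < x"
    using k unfolding x_def[symmetric] by linarith+
  have "real m * x \<le> real m * real k" using ge by (intro mult_left_mono) auto
  then have "real b + 1 \<le> real (m * k)" using mx by simp
  then show "m * k > b" by linarith
  have "real m * real (k - 1) < real m * x" using lt assms(1) by (intro mult_strict_left_mono) auto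
  then have "real (m * (k - 1)) < real b + 1" using mx by simp
  then show "m * (k - 1) \<le> b" by linarith
qed

theorem theorem2:
  fixes m b s :: nat
  assumes "m \<ge> 1" and "b \<ge> 1" and "s \<ge> 1"
  shows
    "(s \<le> m \<or> b < m \<longrightarrow>
        weak_threshold s (has_winning_strategy m b Maker) (\<lambda>n. real n powr (- real s)))
     \<and>
     (m = s - 1 \<and> s - 1 \<le> b \<longrightarrow>
        weak_threshold s (has_winning_strategy m b Maker)
          (\<lambda>n. real n powr
                 (1 - real s - inverse (real_of_int \<lceil>(real b + 1) / real m\<rceil>))))
     \<and>
     (m + 2 \<le> s \<and> m \<le> b \<longrightarrow>
        weak_threshold s (has_winning_strategy m b Maker) (\<lambda>n. real n powr (1 - real s)) \<and>
        (\<exists>c\<^sub>1 c\<^sub>2 :: real. 0 < c\<^sub>1 \<and> c\<^sub>1 \<le> c\<^sub>2 \<and>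
           (\<forall>p. edge_prob p \<longrightarrow>
              ((\<forall>\<^sub>F n in sequentially. p n \<le> c\<^sub>1 * real n powr (1 - real s)) \<longrightarrow>
                 whp s p (has_winning_strategy m b Breaker)) \<and>
              ((\<forall>\<^sub>F n in sequentially. p n \<ge> c\<^sub>2 * real n powr (1 - real s)) \<longrightarrow>
                 whp s p (has_winning_strategy m b Maker)))))"
proof (intro conjI impI)
  assume "s \<le> m \<or> b < m"
  then show "weak_threshold s (has_winning_strategy m b Maker) (\<lambda>n. real n powr (- real s))"
    unfolding weak_threshold_def
    using whp_Maker_disjoint_edges whp_not_Maker[OF assms(1,2) whp_Breaker_no_edges] assms by blast
next
  assume ms: "m = s - 1 \<and> s - 1 \<le> b"
  define k where "k = nat \<lceil>(real b + 1) / real m\<rceil>"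
  note k = ceiling_division[OF assms(1), of b, folded k_def]
  have s: "s = Suc m" using ms assms by simp
  have "1 - real s - inverse (real_of_int \<lceil>(real b + 1) / real m\<rceil>) = - (real m + 1 / real k)"
    unfolding k(4) by (simp add: s inverse_eq_divide)
  then show "weak_threshold s (has_winning_strategy m b Maker)
      (\<lambda>n. real n powr (1 - real s - inverse (real_of_int \<lceil>(real b + 1) / real m\<rceil>)))"
    unfolding weak_threshold_def
    using whp_Maker_stars[OF s assms(1) k(1,3)]
      whp_not_Maker[OF assms(1,2) whp_Breaker_small_degree[OF s k(1,2)]] by simp
next
  assume ms: "m + 2 \<le> s \<and> m \<le> b"
  define d where "d = s - 1"
  have d: "s = Suc d" "d \<ge> 1" "m < d" using ms by (auto simp: d_def)
  \<comment> \<open>The constants required by \<open>whp_Breaker_sparse\<close> and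
    \<open>whp_Maker_dense\<close>; they are compared through 1, which lies between them.\<close>
  define c\<^sub>1 :: real where "c\<^sub>1 = 1 / (exp (real (Suc d)) * real d * 4 ^ d)"
  define c\<^sub>2 where "c\<^sub>2 = 2 * real s ^ s * (real (b * (b * 2 * (b + 1) ^ s)) + 1)"
  have powr: "\<forall>\<^sub>F n in sequentially. real n powr (1 - real s) = 1 / real n ^ d"
    using eventually_gt_at_top[of 0]
    by eventually_elim (simp add: d(1) powr_minus powr_realpow divide_inverse)
  have c1: "0 < c\<^sub>1" "c\<^sub>1 \<le> 1"
  proof -
    show "0 < c\<^sub>1" using d by (simp add: c\<^sub>1_def)
    have "1 * 1 * 1 \<le> exp (real (Suc d)) * real d * 4 ^ d"
      using d by (intro mult_mono) auto
    then show "c\<^sub>1 \<le> 1" by (simp add: c\<^sub>1_def divide_le_eq_1)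
  qed
  have c2: "1 \<le> c\<^sub>2"
  proof -
    have "1 * 1 \<le> real s ^ s * (real (b * (b * 2 * (b + 1) ^ s)) + 1)"
      using assms by (intro mult_mono) (auto simp: one_le_power)
    then show ?thesis unfolding c\<^sub>2_def by simp
  qed
  have Breaker: "whp s p (has_winning_strategy m b Breaker)"
    if "edge_prob p" "\<forall>\<^sub>F n in sequentially. p n \<le> c\<^sub>1 * real n powr (1 - real s)" for p
    unfolding d(1)
  proof (rule whp_Breaker_sparse[OF d(2,3) _ that(1)])
    show "\<forall>\<^sub>F n in sequentially. p n \<le> 1 / (exp (real (Suc d)) * real d * 4 ^ d) / real n ^ d"
      using that(2) powr by eventually_elim (simp add: c\<^sub>1_def)
  qed (use ms in simp)
  have Maker: "whp s p (has_winning_strategy m b Maker)"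
    if "edge_prob p" "\<forall>\<^sub>F n in sequentially. p n \<ge> c\<^sub>2 * real n powr (1 - real s)" for p
  proof (rule whp_Maker_dense[OF _ assms(1) that(1)])
    show "\<forall>\<^sub>F n in sequentially.
        2 * real s ^ s * (real (b * (b * 2 * (b + 1) ^ s)) + 1) / real n ^ (s - 1) \<le> p n"
      unfolding c\<^sub>2_def[symmetric] using that(2) powr by eventually_elim (simp add: d_def)
  qed (use ms in simp)
  \<comment> \<open>Follows from the semi-sharp bounds: a function in \<open>\<omega>\<close>
    eventually exceeds the multiple \<open>c\<^sub>2\<close>, and one in \<open>o\<close> eventually
    stays below the multiple \<open>c\<^sub>1\<close>.\<close>
  show "weak_threshold s (has_winning_strategy m b Maker) (\<lambda>n. real n powr (1 - real s))"
    unfolding weak_threshold_def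
  proof (intro allI impI conjI)
    fix p assume p: "edge_prob p"
    have nonneg: "0 \<le> p n" for n using p by (simp add: edge_prob_def)
    show "whp s p (has_winning_strategy m b Maker)" if "p \<in> \<omega>(\<lambda>n. real n powr (1 - real s))"
    proof (rule Maker[OF p])
      show "\<forall>\<^sub>F n in sequentially. c\<^sub>2 * real n powr (1 - real s) \<le> p n"
        using landau_omega.smallD[OF that, of "c\<^sub>2"] c2 nonneg by simp
    qed
    show "whp s p (\<lambda>H. \<not> has_winning_strategy m b Maker H)" if "p \<in> o(\<lambda>n. real n powr (1 - real s))"
    proof (rule whp_not_Maker[OF assms(1,2) Breaker[OF p]])
      show "\<forall>\<^sub>F n in sequentially. p n \<le> c\<^sub>1 * real n powr (1 - real s)"
        using landau_o.smallD[OF that c1(1)] nonneg by simp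
    qed
  qed
  show "\<exists>c\<^sub>1 c\<^sub>2 :: real. 0 < c\<^sub>1 \<and> c\<^sub>1 \<le> c\<^sub>2 \<and>
           (\<forall>p. edge_prob p \<longrightarrow>
              ((\<forall>\<^sub>F n in sequentially. p n \<le> c\<^sub>1 * real n powr (1 - real s)) \<longrightarrow>
                 whp s p (has_winning_strategy m b Breaker)) \<and>
              ((\<forall>\<^sub>F n in sequentially. p n \<ge> c\<^sub>2 * real n powr (1 - real s)) \<longrightarrow>
                 whp s p (has_winning_strategy m b Maker)))"
    using c1 c2 Breaker Maker by (intro exI[of _ c\<^sub>1] exI[of _ c\<^sub>2]) auto
qed

end
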